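(* As $p\to+\infty$, $r_p^{2/(p-1)}\to \bar t\, e^{-\frac{\bar t}{2(\bar t+\sqrt e)}}\ (\approx0.67)$.
   Context: Let $B$ be the open unit ball in $\mathbb R^2$. For $p>1$, $u_p$ denotes a least energy nodal radial solution of $-\Delta u=|u|^{p-1}u$ in $B$, $u=0$ on $\partial B$: a radial function in $H^1_0(B)$ solving this problem, with $u_p^\pm\neq0$, minimizing $E_p(u)=\frac12\int_B|\nabla u|^2-\frac1{p+1}\int_B|u|^{p+1}$ among radial functions of the nodal Nehari set $\{u\in H^1_0(B): u^\pm\neq0,\ \int_B|\nabla u^\pm|^2=\int_B|u^\pm|^{p+1}\}$. It has two nodal regions; normalize $u_p(0)<0$. $r_p\in(0,1)$ is the nodal radius: $u_p(x)=0$ iff $|x|=r_p$ (for $x\in B$). $\bar t\approx0.7875$ is the unique positive root of $2\sqrt e\log t+t=0$. *)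

theory Defs
  imports "HOL-Analysis.Analysis"
begin

type_synonym R2 = "real ^ 2"

definition unit_ball :: "R2 set" where
  "unit_ball = ball 0 1"

definition test_fun :: "R2 set \<Rightarrow> (R2 \<Rightarrow> real) \<Rightarrow> (R2 \<Rightarrow> R2) \<Rightarrow> bool" where
  "test_fun S \<phi> G \<longleftrightarrow>
     (\<forall>x. (\<phi> has_derivative (\<lambda>h. G x \<bullet> h)) (at x)) \<and> continuous_on UNIV G \<and>
     compact (closure {x. \<phi> x \<noteq> 0}) \<and> closure {x. \<phi> x \<noteq> 0} \<subseteq> S"

definition weak_gradient :: "(R2 \<Rightarrow> real) \<Rightarrow> (R2 \<Rightarrow> R2) \<Rightarrow> bool" where
  "weak_gradient u g \<longleftrightarrow>
     g \<in> borel_measurable lborel \<and>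
     (\<forall>i. integrable lborel (\<lambda>x. (g x $ i)\<^sup>2)) \<and>
     (\<forall>\<phi> G. test_fun UNIV \<phi> G \<longrightarrow>
        (\<forall>i. (LINT x|lborel. u x * (G x $ i)) = - (LINT x|lborel. (g x $ i) * \<phi> x)))"

text \<open>H^1_0(B), realised as H^1(R^2) functions vanishing outside B (B is a ball, so this is the standard space).\<close>
definition H10 :: "(R2 \<Rightarrow> real) \<Rightarrow> bool" where
  "H10 u \<longleftrightarrow> u \<in> borel_measurable lborel \<and> integrable lborel (\<lambda>x. (u x)\<^sup>2) \<and>
     (\<exists>g. weak_gradient u g) \<and> (\<forall>x. x \<notin> unit_ball \<longrightarrow> u x = 0)"

definition wgrad :: "(R2 \<Rightarrow> real) \<Rightarrow> R2 \<Rightarrow> R2" where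
  "wgrad u = (SOME g. weak_gradient u g)"

definition dirichlet :: "(R2 \<Rightarrow> real) \<Rightarrow> real" where
  "dirichlet u = (LINT x|lborel. (norm (wgrad u x))\<^sup>2)"

definition pos_part :: "(R2 \<Rightarrow> real) \<Rightarrow> R2 \<Rightarrow> real" where
  "pos_part u = (\<lambda>x. max (u x) 0)"

definition neg_part :: "(R2 \<Rightarrow> real) \<Rightarrow> R2 \<Rightarrow> real" where
  "neg_part u = (\<lambda>x. max (- u x) 0)"

definition nonzero_fun :: "(R2 \<Rightarrow> real) \<Rightarrow> bool" where
  "nonzero_fun v \<longleftrightarrow> \<not> (AE x in lborel. v x = 0)"

definition radial :: "(R2 \<Rightarrow> real) \<Rightarrow> bool" where
  "radial u \<longleftrightarrow> (\<forall>x y. norm x = norm y \<longrightarrow> u x = u y)"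

definition energy :: "real \<Rightarrow> (R2 \<Rightarrow> real) \<Rightarrow> real" where
  "energy p u = dirichlet u / 2 - (LINT x|lborel. \<bar>u x\<bar> powr (p + 1)) / (p + 1)"

definition nodal_nehari :: "real \<Rightarrow> (R2 \<Rightarrow> real) set" where
  "nodal_nehari p = {u. H10 u \<and> nonzero_fun (pos_part u) \<and> nonzero_fun (neg_part u) \<and>
      dirichlet (pos_part u) = (LINT x|lborel. (pos_part u x) powr (p + 1)) \<and>
      dirichlet (neg_part u) = (LINT x|lborel. (neg_part u x) powr (p + 1))}"

definition weak_solution :: "real \<Rightarrow> (R2 \<Rightarrow> real) \<Rightarrow> bool" where
  "weak_solution p u \<longleftrightarrow> H10 u \<and>
     (\<forall>\<phi> G. test_fun unit_ball \<phi> G \<longrightarrow>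
        (LINT x|lborel. wgrad u x \<bullet> G x) = (LINT x|lborel. \<bar>u x\<bar> powr (p - 1) * u x * \<phi> x))"

definition least_energy_nodal_radial :: "real \<Rightarrow> (R2 \<Rightarrow> real) \<Rightarrow> bool" where
  "least_energy_nodal_radial p u \<longleftrightarrow>
     radial u \<and> weak_solution p u \<and> u \<in> nodal_nehari p \<and>
     (\<forall>v. v \<in> nodal_nehari p \<and> radial v \<longrightarrow> energy p u \<le> energy p v)"

definition t_bar :: real where
  "t_bar = (THE t. 0 < t \<and> 2 * sqrt (exp 1) * ln t + t = 0)"

end

theory Submission
  imports Defs "HOL-Real_Asymp.Real_Asymp"
begin

text \<open>
  Only the equation and the nodal structure matter, not the minimality of the energy. With \<open>n = p - 1\<close>,
  \<open>|x|\<^sup>2 = exp (n y)\<close> and \<open>V y = - u x\<close>, the radial equation becomes \<open>V'' = - n\<^sup>2/4 |exp y V|\<^sup>n V\<close> on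
  \<open>y < 0\<close>. As \<open>n \<rightarrow> \<infinity>\<close> the force vanishes where \<open>|exp y V| < 1\<close> and becomes a hard wall at
  \<open>|exp y V| = 1\<close>: in the limit \<open>V\<close> is piecewise linear and \<open>\<phi> = exp y V\<close> is reflected elastically,
  \<open>\<phi>' \<mapsto> - \<phi>'\<close>, at the wall. Shift \<open>y\<close> and rescale \<open>V\<close>, keeping the equation, so that \<open>V = 1\<close> at \<open>-\<infinity>\<close>. Then
  \<open>V\<close> is constant up to the first bounce at \<open>y = 0\<close>, equals \<open>1 - 2 y\<close> after it, vanishes at \<open>y = 1/2\<close>,
  bounces at \<open>1/2 - ln t\<close> with \<open>2 \<surd>e ln t + t = 0\<close>, and vanishes again after the further time
  \<open>t / (2 (t + \<surd>e))\<close>. The distance between the two zeros is the limit of \<open>- (2/n) ln r\<close>.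
\<close>

text \<open>The force near \<phi> = 1 has no uniform bound, so the bounce is not followed through
  the equation itself. Three facts replace this. The energy satisfies 0 <= E' <= 4 E, hence is
  almost conserved over a short time. Contact is short: v is concave, and it cannot stay long
  between the convex curves (1 - d) exp (- x) and exp (- x). With d = 1 / sqrt n the potential
  energy at \<phi> = 1 - d tends to 0, so in the limit \<phi>' has the same square at both ends of
  the contact and only its sign changes. The factor sqrt e comes from rescaling: the second arc
  starts at y = 1/2 with slope of modulus 2, which becomes 2 sqrt e once the arc is moved to the
  origin; it meets the wall when 2 sqrt e x exp x = 1, the equation of t for t = exp (- x). A weak
  solution is not yet a solution of an ODE. In the variable |x|^2, radial test functions turn the
  weak equation into a du Bois-Reymond identity. The boundary condition, encoded only as u = 0
  outside the ball, becomes a limit by testing with fields that straddle the unit sphere.\<close>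

section \<open>Arcs between two zeros\<close>

text \<open>With \<open>\<phi> x = exp x * v x\<close> the equation \<open>v'' = - n\<^sup>2/4 \<phi>\<^sup>n v\<close> reads
  \<open>\<phi>'' = 2 \<phi>' - \<phi> - n\<^sup>2/4 \<phi>\<^sup>n\<^sup>+\<^sup>1\<close>; the energy below satisfies \<open>E' = 2 \<phi>'\<^sup>2\<close>.\<close>
definition arc_energy :: "real \<Rightarrow> (real \<Rightarrow> real) \<Rightarrow> (real \<Rightarrow> real) \<Rightarrow> real \<Rightarrow> real" where
  "arc_energy n v v' x = (exp x * (v x + v' x))\<^sup>2 / 2 + (exp x * v x)\<^sup>2 / 2
     + n\<^sup>2 / (4 * (n + 2)) * (exp x * v x) powr (n + 2)"

text \<open>Derivatives are assumed only left of \<open>B\<close>: the second arc ends on the unit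
  circle, where only continuity is known. \<open>v_0\<close> admits both a start at a positive value
  (first arc) and a start at a zero (second arc).\<close>

locale bounce_arc =
  fixes n B :: real and v v' :: "real \<Rightarrow> real"
  assumes n_pos: "0 < n" and B_pos: "0 < B"
    and dv: "\<And>x. 0 \<le> x \<Longrightarrow> x < B \<Longrightarrow> (v has_real_derivative v' x) (at x)"
    and dv': "\<And>x. 0 \<le> x \<Longrightarrow> x < B \<Longrightarrow>
      (v' has_real_derivative - (n\<^sup>2 / 4 * (exp x * v x) powr n * v x)) (at x)"
    and cont: "continuous_on {0..B} v"
    and v_pos: "\<And>x. 0 < x \<Longrightarrow> x < B \<Longrightarrow> 0 < v x"
    and v_0: "0 \<le> v 0" and v_B: "v B = 0"
begin

lemma v_nonneg: "0 \<le> x \<Longrightarrow> x \<le> B \<Longrightarrow> 0 \<le> v x"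
  using v_pos[of x] v_0 v_B by (cases "x = 0"; cases "x = B") auto

abbreviation E :: "real \<Rightarrow> real" where
  "E \<equiv> arc_energy n v v'"

lemma E_nonneg: "0 \<le> E x"
  unfolding arc_energy_def using n_pos by (intro add_nonneg_nonneg mult_nonneg_nonneg) auto

text \<open>Multiply the equation for \<phi> by \<phi>': the term 2 \<phi>' acts as negative
  friction and everything else is conservative. Inside the arc \<phi> > 0, as the rule for
  differentiating \<open>powr\<close> requires.\<close>

lemma dE:
  assumes "0 < x" "x < B"
  shows "(E has_real_derivative 2 * (exp x * (v x + v' x))\<^sup>2) (at x)"
proof -
  define w where "w = exp x * v x"
  have w: "0 < w" using v_pos[OF assms] by (simp add: w_def)
  have d1: "(v has_real_derivative v' x) (at x)" using dv assms by simp
  have d2: "(v' has_real_derivative - (n\<^sup>2 / 4 * w powr n * v x)) (at x)" using dv' assms by (simp add: w_def)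
  have p: "w powr (n + 2) = w powr n * w\<^sup>2" "w powr (n + 1) = w powr n * w"
    using w by (simp_all add: powr_add)
  have dw: "((\<lambda>x. exp x * v x) has_real_derivative exp x * (v x + v' x)) (at x)"
    by (auto intro!: derivative_eq_intros d1 simp: algebra_simps)
  have dp: "((\<lambda>x. (exp x * v x) powr (n + 2)) has_real_derivative
      (n + 2) * w powr (n + 1) * (exp x * (v x + v' x))) (at x)"
    using DERIV_fun_powr[OF dw, of "n + 2"] w by (simp add: w_def add.commute)
  have p': "exp x * v x * w powr n = w powr (n + 1)" using p by (simp add: w_def)
  have "((\<lambda>x. exp x * (v x + v' x)) has_real_derivative
      exp x * (v x + 2 * v' x) - n\<^sup>2 / 4 * (exp x * v x * w powr n)) (at x)"
    by (auto intro!: derivative_eq_intros d1 d2 simp: algebra_simps)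
  then have dz: "((\<lambda>x. exp x * (v x + v' x)) has_real_derivative
      exp x * (v x + 2 * v' x) - n\<^sup>2 / 4 * w powr (n + 1)) (at x)"
    by (simp only: p')
  have "((\<lambda>x. (exp x * (v x + v' x))\<^sup>2 / 2 + (exp x * v x)\<^sup>2 / 2 + n\<^sup>2 / (4 * (n + 2)) * (exp x * v x) powr (n + 2))
     has_real_derivative (exp x * (v x + v' x)) * (exp x * (v x + 2 * v' x) - n\<^sup>2 / 4 * w powr (n + 1))
       + w * (exp x * (v x + v' x)) + n\<^sup>2 / (4 * (n + 2)) * ((n + 2) * w powr (n + 1) * (exp x * (v x + v' x)))) (at x)"
    by (rule derivative_eq_intros dz dw dp refl | simp add: w_def)+
  moreover have "(exp x * (v x + v' x)) * (exp x * (v x + 2 * v' x) - n\<^sup>2 / 4 * w powr (n + 1))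
       + w * (exp x * (v x + v' x)) + n\<^sup>2 / (4 * (n + 2)) * ((n + 2) * w powr (n + 1) * (exp x * (v x + v' x)))
      = 2 * (exp x * (v x + v' x))\<^sup>2"
    using n_pos by (simp add: w_def field_simps power2_eq_square)
  ultimately show ?thesis by (simp add: arc_energy_def[abs_def])
qed

lemma cont_v': "continuous_on {0..<B} v'"
  by (rule continuous_at_imp_continuous_on) (force intro: DERIV_isCont[OF dv'])

lemma cont_E: "continuous_on {0..<B} E"
proof -
  have v: "continuous_on {0..<B} v" using cont by (rule continuous_on_subset) auto
  have p: "continuous_on {0..<B} (\<lambda>x. (exp x * v x) powr (n + 2))"
    by (rule continuous_on_powr') (use n_pos v_nonneg in \<open>auto intro!: continuous_intros v\<close>)
  show ?thesis
    unfolding arc_energy_def[abs_def]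
    by (rule continuous_on_add[OF _ continuous_on_mult[OF continuous_on_const p]])
      (intro continuous_intros v cont_v', auto)
qed

lemma E_mono:
  assumes "0 \<le> x" "x \<le> y" "y < B"
  shows "E x \<le> E y"
proof (rule DERIV_nonneg_imp_increasing_open[OF assms(2)])
  show "continuous_on {x..y} E" using cont_E by (rule continuous_on_subset) (use assms in auto)
  show "\<exists>d. (E has_real_derivative d) (at z) \<and> 0 \<le> d" if "x < z" "z < y" for z
    using dE[of z] that assms by auto
qed

text \<open>Gronwall: \<phi>'^2 / 2 is one of the summands of E, so E' <= 4 E.\<close>

lemma E_growth:
  assumes "0 \<le> x" "x \<le> y" "y < B"
  shows "E y \<le> E x * exp (4 * (y - x))"
proof -
  have "E y * exp (-4 * y) \<le> E x * exp (-4 * x)"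
  proof (rule DERIV_nonpos_imp_decreasing_open[OF assms(2)])
    show "continuous_on {x..y} (\<lambda>x. E x * exp (-4 * x))"
      by (intro continuous_intros continuous_on_subset[OF cont_E]) (use assms in auto)
    show "\<exists>d. ((\<lambda>x. E x * exp (-4 * x)) has_real_derivative d) (at z) \<and> d \<le> 0" if "x < z" "z < y" for z
    proof -
      have "((\<lambda>x. E x * exp (-4 * x)) has_real_derivative
          (2 * (exp z * (v z + v' z))\<^sup>2 - 4 * E z) * exp (-4 * z)) (at z)"
        using that assms by (auto intro!: derivative_eq_intros dE simp: algebra_simps)
      moreover have "(exp z * (v z + v' z))\<^sup>2 / 2 \<le> E z"
        unfolding arc_energy_def using n_pos by simp
      ultimately show ?thesis by (intro exI conjI) (auto intro!: mult_nonpos_nonneg)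
    qed
  qed
  then have "E y * exp (-4 * y) * exp (4 * y) \<le> E x * exp (-4 * x) * exp (4 * y)" by simp
  then show ?thesis by (simp add: mult.assoc right_diff_distrib flip: exp_add)
qed

text \<open>The wall cannot be pierced: beyond \<phi> = 1 the potential alone exceeds n^2 / (4 (n +
  2)), which is of order n, while the energy stays bounded on the window up to
  \<open>X\<close>.\<close>

lemma phi_le_1:
  assumes "4 * (n + 2) / n\<^sup>2 * (E 0 * exp (4 * X)) \<le> 1" "0 \<le> x" "x < B" "x \<le> X"
  shows "exp x * v x \<le> 1"
proof (rule ccontr)
  assume "\<not> ?thesis"
  then have "1 < (exp x * v x) powr (n + 2)" using n_pos by (intro gr_one_powr) auto
  also have "\<dots> \<le> 4 * (n + 2) / n\<^sup>2 * E x"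
  proof -
    have "n\<^sup>2 / (4 * (n + 2)) * (exp x * v x) powr (n + 2) \<le> E x" by (simp add: arc_energy_def)
    then show ?thesis using n_pos by (simp add: field_simps)
  qed
  also have "\<dots> \<le> 4 * (n + 2) / n\<^sup>2 * (E 0 * exp (4 * X))"
  proof (rule mult_left_mono)
    have "E x \<le> E 0 * exp (4 * x)" using E_growth[of 0 x] assms by simp
    also have "\<dots> \<le> E 0 * exp (4 * X)" using assms by (simp add: mult_left_mono E_nonneg)
    finally show "E x \<le> E 0 * exp (4 * X)" .
  qed (use n_pos in auto)
  finally show False using assms(1) by simp
qed

lemma v'_antimono:
  assumes "0 \<le> x" "x \<le> y" "y < B"
  shows "v' y \<le> v' x"
proof (rule DERIV_nonpos_imp_nonincreasing[OF assms(2)])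
  show "\<exists>d. (v' has_real_derivative d) (at z) \<and> d \<le> 0" if "x \<le> z" "z \<le> y" for z
    using dv'[of z] v_nonneg[of z] that assms n_pos by (intro exI conjI) auto
qed

text \<open>The force is attractive, so v is concave; this is what bounds the duration of the
  contact.\<close>

lemma midpoint:
  assumes "0 \<le> a" "a \<le> b" "b < B"
  shows "(v a + v b) / 2 \<le> v ((a + b) / 2)"
proof -
  have "convex_on {0..<B} (\<lambda>x. - v x)"
  proof (rule convex_on_realI)
    show "((\<lambda>x. - v x) has_real_derivative - v' x) (at x)" if "x \<in> {0..<B}" for x
      using that by (auto intro!: derivative_eq_intros dv)
  qed (auto intro: v'_antimono)
  from convex_onD[OF this, of "1/2" a b] show ?thesis
    using assms by (simp add: field_simps)
qed

text \<open>Where \<phi> <= 1 - d the deceleration is at most \<open>k\<close>, so v follows its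
  tangent at \<open>y\<close> up to an error of order \<open>k\<close>. The lower bound uses the
  worst slope on the whole of [y, z]; the upper bound is concavity.\<close>

lemma free_flight:
  assumes "0 < d" "d < 1" "0 \<le> y" "y \<le> z" "z \<le> B"
    and free: "\<And>x. y < x \<Longrightarrow> x < z \<Longrightarrow> v x \<le> (1 - d) * exp (- x)"
  defines "k \<equiv> n\<^sup>2 / 4 * (1 - d) powr n"
  shows "\<And>x. y \<le> x \<Longrightarrow> x \<le> z \<Longrightarrow> x < B \<Longrightarrow> v' y - k * (x - y) \<le> v' x"
    and "\<And>x. y \<le> x \<Longrightarrow> x \<le> z \<Longrightarrow> v y + (v' y - k * (z - y)) * (x - y) \<le> v x"
    and "\<And>x. y \<le> x \<Longrightarrow> x \<le> z \<Longrightarrow> v x \<le> v y + v' y * (x - y)"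
proof -
  have k: "0 \<le> k" by (simp add: k_def)
  have acc: "n\<^sup>2 / 4 * (exp x * v x) powr n * v x \<le> k" if "y < x" "x < z" for x
  proof -
    have x: "0 < x" "x < B" using that assms by auto
    have "exp x * v x \<le> 1 - d"
      using free[OF that] by (simp add: exp_minus field_simps)
    then have "(exp x * v x) powr n \<le> (1 - d) powr n"
      using v_pos[OF x] n_pos by (intro powr_mono2) auto
    moreover have "v x \<le> 1"
    proof -
      have "v x \<le> (1 - d) * exp (- x)" by (rule free[OF that])
      also have "\<dots> \<le> 1 * 1" using assms x by (intro mult_mono) auto
      finally show ?thesis by simp
    qed
    ultimately have "(exp x * v x) powr n * v x \<le> (1 - d) powr n * 1"
      using v_pos[OF x] by (intro mult_mono) auto
    then have "n\<^sup>2 / 4 * ((exp x * v x) powr n * v x) \<le> n\<^sup>2 / 4 * ((1 - d) powr n * 1)"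
      by (intro mult_left_mono) auto
    then show ?thesis by (simp add: k_def mult.assoc)
  qed
  show 1: "v' y - k * (x - y) \<le> v' x" if "y \<le> x" "x \<le> z" "x < B" for x
  proof -
    have "v' y + k * y \<le> v' x + k * x"
    proof (rule DERIV_nonneg_imp_increasing_open[OF that(1)])
      show "continuous_on {y..x} (\<lambda>x. v' x + k * x)"
        by (intro continuous_intros continuous_on_subset[OF cont_v']) (use assms that in auto)
      show "\<exists>d. ((\<lambda>x. v' x + k * x) has_real_derivative d) (at w) \<and> 0 \<le> d" if w: "y < w" "w < x" for w
      proof (intro exI conjI)
        show "((\<lambda>x. v' x + k * x) has_real_derivative - (n\<^sup>2 / 4 * (exp w * v w) powr n * v w) + k) (at w)"
          using w that assms \<open>x \<le> z\<close> by (auto intro!: derivative_eq_intros dv')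
        show "0 \<le> - (n\<^sup>2 / 4 * (exp w * v w) powr n * v w) + k"
          using acc[of w] w \<open>x \<le> z\<close> by simp
      qed
    qed
    then show ?thesis by (simp add: algebra_simps)
  qed
  have c: "continuous_on {y..x} v" if "x \<le> z" for x
    using cont by (rule continuous_on_subset) (use assms that in auto)
  show "v y + (v' y - k * (z - y)) * (x - y) \<le> v x" if "y \<le> x" "x \<le> z" for x
  proof -
    have "v y - (v' y - k * (z - y)) * y \<le> v x - (v' y - k * (z - y)) * x"
    proof (rule DERIV_nonneg_imp_increasing_open[OF that(1)])
      show "continuous_on {y..x} (\<lambda>x. v x - (v' y - k * (z - y)) * x)"
        by (intro continuous_intros c that)
      show "\<exists>d. ((\<lambda>x. v x - (v' y - k * (z - y)) * x) has_real_derivative d) (at w) \<and> 0 \<le> d"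
        if w: "y < w" "w < x" for w
      proof (intro exI conjI)
        show "((\<lambda>x. v x - (v' y - k * (z - y)) * x) has_real_derivative v' w - (v' y - k * (z - y))) (at w)"
          using w assms \<open>x \<le> z\<close> by (auto intro!: derivative_eq_intros dv)
        have "k * (w - y) \<le> k * (z - y)" using k w \<open>x \<le> z\<close> by (intro mult_left_mono) auto
        then show "0 \<le> v' w - (v' y - k * (z - y))"
          using 1[of w] w \<open>x \<le> z\<close> assms by simp
      qed
    qed
    then show ?thesis by (simp add: algebra_simps)
  qed
  show "v x \<le> v y + v' y * (x - y)" if "y \<le> x" "x \<le> z" for x
  proof -
    have "v x - v' y * x \<le> v y - v' y * y"
    proof (rule DERIV_nonpos_imp_decreasing_open[OF that(1)])
      show "continuous_on {y..x} (\<lambda>x. v x - v' y * x)"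
        by (intro continuous_intros c that)
      show "\<exists>d. ((\<lambda>x. v x - v' y * x) has_real_derivative d) (at w) \<and> d \<le> 0"
        if w: "y < w" "w < x" for w
      proof (intro exI conjI)
        show "((\<lambda>x. v x - v' y * x) has_real_derivative v' w - v' y) (at w)"
          using w assms \<open>x \<le> z\<close> by (auto intro!: derivative_eq_intros dv)
        show "v' w - v' y \<le> 0"
          using v'_antimono[of y w] w \<open>x \<le> z\<close> assms by simp
      qed
    qed
    then show ?thesis by (simp add: algebra_simps)
  qed
qed

text \<open>\<open>a\<close> and \<open>b\<close> are the first and last times in [0, min B X] at
  which \<phi> >= 1 - d. The window \<open>X\<close> makes the energy bound uniform. The information
  at \<open>b\<close> is guarded by \<open>b < X\<close>, since otherwise the window, and not the
  end of the contact, may have stopped the search.\<close>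

lemma bounce_points:
  assumes small: "4 * (n + 2) / n\<^sup>2 * (E 0 * exp (4 * X)) \<le> 1"
    and d: "0 < d" "d < 1" and start: "v 0 < 1 - d" and X: "0 < X"
    and reach: "0 \<le> x0" "x0 \<le> min B X" "(1 - d) * exp (- x0) \<le> v x0"
  defines "k \<equiv> n\<^sup>2 / 4 * (1 - d) powr n"
  obtains a b where "0 \<le> a" "a \<le> b" "b < B" "b \<le> X" "(b - a)\<^sup>2 \<le> 8 * (1 / (1 - d) - 1)"
    "v a = (1 - d) * exp (- a)"
    "v 0 + (v' 0 - k * a) * a \<le> v a" "v a \<le> v 0 + v' 0 * a"
    "v' 0 - k * a \<le> v' a" "v' a \<le> v' 0"
    "E a \<le> E b" "E b \<le> E a * exp (4 * (b - a))"
    "b < X \<longrightarrow> v b = (1 - d) * exp (- b) \<and> v b + v' b \<le> 0 \<and>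
      (\<forall>x. b < x \<and> x < min B X \<longrightarrow> v x \<le> (1 - d) * exp (- x))"
proof -
  define D where "D = min B X"
  define g where "g x = v x - (1 - d) * exp (- x)" for x
  define S where "S = {x \<in> {0..D}. 0 \<le> g x}"
  have g: "continuous_on {0..B} g" unfolding g_def by (intro continuous_intros cont)
  then have gD: "continuous_on {0..D} g" by (rule continuous_on_subset) (auto simp: D_def)
  have "closed S" unfolding S_def
    using continuous_closed_preimage[OF gD, of "{0..}"] by (simp add: vimage_def Int_def conj_commute)
  moreover have "x0 \<in> S" using reach by (auto simp: S_def D_def g_def)
  moreover have bdd: "bdd_below S" "bdd_above S" by (auto simp: S_def intro!: bdd_belowI[of _ 0] bdd_aboveI[of _ D])
  ultimately have mem: "Inf S \<in> S" "Sup S \<in> S"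
    using closed_contains_Inf[of S] closed_contains_Sup[of S] by auto
  define a where "a = Inf S"
  define b where "b = Sup S"
  have ab: "0 \<le> a" "a \<le> b" "b \<le> D" "0 \<le> g a" "0 \<le> g b"
    using mem cInf_lower[OF mem(2) bdd(1)] by (auto simp: a_def b_def S_def)
  \<comment> \<open>As v vanishes at \<open>B\<close>, the contact ends strictly before the arc
    does, where v is still differentiable.\<close>
  have gB: "g B < 0" using d by (simp add: g_def v_B)
  have bB: "b < B" using ab gB by (cases "b = B") (auto simp: D_def)
  have before: "g x < 0" if "0 \<le> x" "x < a" for x
    using cInf_lower[OF _ bdd(1), of x] that ab by (force simp: S_def a_def)
  have after: "g x < 0" if "b < x" "x \<le> D" for x
    using cSup_upper[OF _ bdd(2), of x] that ab by (force simp: S_def b_def)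
  have g0: "g 0 < 0" using start by (simp add: g_def)
  have ga: "g a = 0"
  proof (rule ccontr)
    assume "g a \<noteq> 0"
    then have "0 < g a" using ab by simp
    then obtain x where "0 \<le> x" "x \<le> a" "g x = 0"
      using IVT'[of g 0 0 a] g0 ab bB continuous_on_subset[OF g, of "{0..a}"] by auto
    then show False using before[of x] \<open>0 < g a\<close> by (cases "x = a") auto
  qed
  have gb: "g b = 0" if "b < X"
  proof (rule ccontr)
    assume "g b \<noteq> 0"
    then have "0 < g b" using ab by simp
    moreover have "b < D" using that bB by (simp add: D_def)
    moreover from this have "g D < 0" using after by simp
    ultimately obtain x where "b \<le> x" "x \<le> D" "g x = 0"
      using IVT2'[of g D 0 b] ab continuous_on_subset[OF g, of "{b..D}"] by (auto simp: D_def)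
    then show False using after[of x] \<open>0 < g b\<close> by (cases "x = b") auto
  qed
  have len: "(b - a)\<^sup>2 \<le> 8 * (1 / (1 - d) - 1)"
  proof -
    define m h where "m = (a + b) / 2" and "h = (b - a) / 2"
    have abm: "a = m - h" "b = m + h" by (simp_all add: m_def h_def field_simps)
    \<comment> \<open>\<open>v\<close> is concave, lies above \<open>(1 - d) exp (- x)\<close> at \<open>a\<close> and \<open>b\<close> and below the convex \<open>exp (- x)\<close>
      in the middle, which forces \<open>b - a\<close> to be small.\<close>
    have "(1 - d) * ((exp (- a) + exp (- b)) / 2) \<le> (v a + v b) / 2"
      using ab by (simp add: g_def field_simps)
    also have "\<dots> \<le> v m" unfolding m_def using midpoint ab bB by auto
    also have "\<dots> \<le> exp (- m)"
      using phi_le_1[OF small, of m] ab bB by (simp add: m_def D_def exp_minus field_simps)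
    finally have "((1 - d) * ((exp h + exp (- h)) / 2)) * exp (- m) \<le> 1 * exp (- m)"
      by (simp add: abm exp_diff exp_add exp_minus field_simps)
    then have "(1 - d) * ((exp h + exp (- h)) / 2) \<le> 1"
      by (subst (asm) mult_le_cancel_right) auto
    then have "(1 - d) * cosh h \<le> 1" by (simp add: cosh_def field_simps)
    moreover have "1 + h\<^sup>2 / 2 \<le> cosh h"
    proof -
      \<comment> \<open>The remainder after the cubic term has the even power 4, so this lower bound
        holds for both signs of t; the odd terms cancel in cosh.\<close>
      have *: "1 + t + t\<^sup>2 / 2 + t ^ 3 / 6 \<le> exp t" for t :: real
      proof -
        obtain z where "exp t = (\<Sum>m<4. t ^ m / fact m) + exp z / fact 4 * t ^ 4"
          using Maclaurin_exp_le[of t 4] by blast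
        moreover have "(\<Sum>m<4. t ^ m / fact m) = 1 + t + t\<^sup>2 / 2 + t ^ 3 / 6"
          by (simp add: numeral_eq_Suc)
        moreover have "0 \<le> exp z / fact 4 * t ^ 4" by (intro mult_nonneg_nonneg) auto
        ultimately show ?thesis by simp
      qed
      show ?thesis using *[of h] *[of "- h"] by (simp add: cosh_def)
    qed
    ultimately have "(1 - d) * (1 + h\<^sup>2 / 2) \<le> 1" using d
      by (smt (verit) mult_left_mono)
    then have "1 + h\<^sup>2 / 2 \<le> 1 / (1 - d)" using d by (simp add: field_simps)
    then show ?thesis by (simp add: h_def power2_eq_square field_simps)
  qed
  show ?thesis
  proof
    show "0 \<le> a" "a \<le> b" "b < B" "b \<le> X" using ab bB by (auto simp: D_def)
    show "(b - a)\<^sup>2 \<le> 8 * (1 / (1 - d) - 1)" by (rule len)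
    show "v a = (1 - d) * exp (- a)" using ga by (simp add: g_def)
    have fl: "v x \<le> (1 - d) * exp (- x)" if "0 < x" "x < a" for x
      using before[of x] that by (simp add: g_def)
    show "v 0 + (v' 0 - k * a) * a \<le> v a"
      using free_flight(2)[OF d, of 0 a a] fl ab bB by (simp add: k_def)
    show "v a \<le> v 0 + v' 0 * a"
      using free_flight(3)[OF d, of 0 a a] fl ab bB by (simp add: k_def)
    show "v' 0 - k * a \<le> v' a"
      using free_flight(1)[OF d, of 0 a a] fl ab bB by (simp add: k_def)
    show "v' a \<le> v' 0" using v'_antimono[of 0 a] ab bB by simp
    show "E a \<le> E b" "E b \<le> E a * exp (4 * (b - a))"
      using E_mono[of a b] E_growth[of a b] ab bB by auto
    show "b < X \<longrightarrow> v b = (1 - d) * exp (- b) \<and> v b + v' b \<le> 0 \<and>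
      (\<forall>x. b < x \<and> x < min B X \<longrightarrow> v x \<le> (1 - d) * exp (- x))"
    proof (intro impI conjI allI)
      assume b: "b < X"
      show vb: "v b = (1 - d) * exp (- b)" using gb b by (simp add: g_def)
      show "v x \<le> (1 - d) * exp (- x)" if "b < x \<and> x < min B X" for x
        using after[of x] that by (simp add: g_def D_def)
      \<comment> \<open>At \<open>b\<close> the derivative of \<open>g\<close> equals v + v', that
        is exp (- b) \<phi>'. If it were positive, the level 1 - d would still be exceeded just
        after the last contact.\<close>
      show "v b + v' b \<le> 0"
      proof (rule ccontr)
        assume "\<not> ?thesis"
        then have "0 < v' b + (1 - d) * exp (- b)" using vb by simp
        moreover have "(g has_real_derivative v' b + (1 - d) * exp (- b)) (at b)"
          unfolding g_def using ab bB by (auto intro!: derivative_eq_intros dv)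
        ultimately obtain e where e: "0 < e" "\<And>h. 0 < h \<Longrightarrow> h < e \<Longrightarrow> g b < g (b + h)"
          using DERIV_pos_inc_right by blast
        define h where "h = min (e / 2) (D - b)"
        have "0 < h" "h < e" "b + h \<le> D" using e bB b by (auto simp: h_def D_def)
        then show False using e(2)[of h] after[of "b + h"] gb b by auto
      qed
    qed
  qed
qed

end


section \<open>The limit of a single arc\<close>

text \<open>In the limit \<open>v\<close> moves linearly until \<open>\<phi> = 1\<close> at time \<open>T\<close>, where \<open>\<phi>' = s\<close>; then \<open>\<phi>'\<close> flips to
  \<open>- s\<close>, and \<open>v\<close> moves linearly down to its zero. The parameter \<open>e0\<close> keeps \<open>v\<close> from vanishing before the bounce.\<close>
lemma bounce_limit:
  fixes F :: "'i filter" and n B :: "'i \<Rightarrow> real" and v v' :: "'i \<Rightarrow> real \<Rightarrow> real"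
  assumes n: "filterlim n at_top F"
    and arc: "\<forall>\<^sub>F i in F. bounce_arc (n i) (B i) (v i) (v' i)"
    and c: "((\<lambda>i. v i 0) \<longlongrightarrow> c0) F" and b: "((\<lambda>i. v' i 0) \<longlongrightarrow> b0) F"
    and c0: "0 \<le> c0" "c0 < 1" and b0: "0 \<le> b0" and cb: "0 < c0 + b0"
    and T: "0 < T" "(c0 + b0 * T) * exp T = 1"
    and e0: "0 < e0" "\<forall>\<^sub>F i in F. \<forall>x. 0 < x \<and> x \<le> T + 1 \<longrightarrow> 0 < v i 0 + (v' i 0 - e0) * x"
  defines "s \<equiv> 1 + b0 * exp T"
  shows "(B \<longlongrightarrow> T + 1 / (1 + s)) F"
    and "\<And>e. 0 < e \<Longrightarrow> \<forall>\<^sub>F i in F. \<exists>y < B i. \<forall>x. y < x \<and> x < B i \<longrightarrow> \<bar>v' i x + (1 + s) * exp (- T)\<bar> < e"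
proof -
  \<comment> \<open>Since s >= 1, the limit arc ends no later than T + 1/2, and contact will be
    forced by time T + 1; the window T + 2 leaves room for both.\<close>
  define X where "X = T + 2"
  \<comment> \<open>This \<open>d\<close> tends to \<open>0\<close> slowly enough that \<open>n\<^sup>2 (1 - d)\<^sup>n\<close> still vanishes.\<close>
  define d where "d i = 1 / sqrt (n i)" for i
  define k where "k i = (n i)\<^sup>2 / 4 * (1 - d i) powr n i" for i
  have s1: "1 \<le> s" using b0 by (simp add: s_def)
  have d: "(d \<longlongrightarrow> 0) F" unfolding d_def
    by (rule filterlim_compose[OF _ n]) real_asymp
  have k: "(k \<longlongrightarrow> 0) F" unfolding k_def d_def
    by (rule filterlim_compose[OF _ n]) real_asymp
  have ev_n: "\<forall>\<^sub>F i in F. 1 < n i" using n by (simp add: filterlim_at_top_dense)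
  have ev_d: "\<forall>\<^sub>F i in F. 0 < d i \<and> d i < 1"
    using ev_n by eventually_elim (simp add: d_def)
  have ev_k: "\<forall>\<^sub>F i in F. 0 \<le> k i" by (simp add: k_def)
  \<comment> \<open>The potential part of E 0 carries the factor n^2 / (4 (n + 2)), which cancels
    exactly and leaves v(0)^(n + 2). This tends to 0 because v(0) stays below some \<open>c1\<close>
    < 1; the kinetic part keeps a prefactor of order 1 / n.\<close>
  have small: "\<forall>\<^sub>F i in F. 4 * (n i + 2) / (n i)\<^sup>2 * (arc_energy (n i) (v i) (v' i) 0 * exp (4 * X)) \<le> 1"
  proof -
    define c1 where "c1 = (1 + c0) / 2"
    have c1: "0 < c1" "c1 < 1" "c0 < c1" using c0 by (auto simp: c1_def)
    have 1: "((\<lambda>i. 4 * (n i + 2) / (n i)\<^sup>2) \<longlongrightarrow> 0) F"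
      by (rule filterlim_compose[OF _ n]) real_asymp
    have "((\<lambda>x::real. c1 powr (x + 2)) \<longlongrightarrow> 0) at_top" using c1 by real_asymp
    from filterlim_compose[OF this n] have 2: "((\<lambda>i. c1 powr (n i + 2)) \<longlongrightarrow> 0) F" .
    have "((\<lambda>i. 4 * (n i + 2) / (n i)\<^sup>2 * (((v i 0 + v' i 0)\<^sup>2 / 2 + (v i 0)\<^sup>2 / 2) * exp (4 * X))
         + c1 powr (n i + 2) * exp (4 * X)) \<longlongrightarrow> 0 * (((c0 + b0)\<^sup>2 / 2 + c0\<^sup>2 / 2) * exp (4 * X)) + 0 * exp (4 * X)) F"
      by (intro tendsto_intros 1 2 c b) auto
    then have "\<forall>\<^sub>F i in F. 4 * (n i + 2) / (n i)\<^sup>2 * (((v i 0 + v' i 0)\<^sup>2 / 2 + (v i 0)\<^sup>2 / 2) * exp (4 * X))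
         + c1 powr (n i + 2) * exp (4 * X) < 1"
      by (rule order_tendstoD) simp
    moreover have "\<forall>\<^sub>F i in F. v i 0 < c1" using c c1 by (auto dest: order_tendstoD)
    ultimately show ?thesis using ev_n arc
    proof eventually_elim
      case (elim i)
      interpret bounce_arc "n i" "B i" "v i" "v' i" by (rule elim)
      have "v i 0 powr (n i + 2) \<le> c1 powr (n i + 2)"
        using elim v_0 by (intro powr_mono2) auto
      then have "v i 0 powr (n i + 2) * exp (4 * X) \<le> c1 powr (n i + 2) * exp (4 * X)" by simp
      moreover have "4 * (n i + 2) / (n i)\<^sup>2 * (arc_energy (n i) (v i) (v' i) 0 * exp (4 * X))
         = 4 * (n i + 2) / (n i)\<^sup>2 * (((v i 0 + v' i 0)\<^sup>2 / 2 + (v i 0)\<^sup>2 / 2) * exp (4 * X))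
         + v i 0 powr (n i + 2) * exp (4 * X)"
      proof -
        have "4 * (n i + 2) / (n i)\<^sup>2 * ((n i)\<^sup>2 / (4 * (n i + 2))) = 1" using elim by simp
        moreover have "arc_energy (n i) (v i) (v' i) 0 = ((v i 0 + v' i 0)\<^sup>2 / 2 + (v i 0)\<^sup>2 / 2)
            + (n i)\<^sup>2 / (4 * (n i + 2)) * v i 0 powr (n i + 2)"
          by (simp add: arc_energy_def)
        moreover have "p * ((y + q * z) * w) = p * (y * w) + z * w" if "p * q = 1" for p q y z w :: real
          using that by (simp add: algebra_simps)
        ultimately show ?thesis by presburger
      qed
      ultimately show ?case using elim by linarith
    qed
  qed
  have start: "\<forall>\<^sub>F i in F. v i 0 < 1 - d i"
  proof -
    have "((\<lambda>i. v i 0 + d i) \<longlongrightarrow> c0 + 0) F" by (intro tendsto_intros c d)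
    then have "\<forall>\<^sub>F i in F. v i 0 + d i < 1" by (rule order_tendstoD) (use c0 in simp)
    then show ?thesis by eventually_elim simp
  qed
  \<comment> \<open>Without contact the arc would fly freely up to z = min B (T + 1). If z = B, then
    \<open>e0\<close> keeps v positive there, against v B = 0; if z = T + 1, the nearly straight
    line is already above the wall.\<close>
  have reach: "\<forall>\<^sub>F i in F. \<exists>x\<ge>0. x \<le> min (B i) X \<and> (1 - d i) * exp (- x) \<le> v i x"
  proof -
    have "((\<lambda>i. k i * (T + 1)) \<longlongrightarrow> 0 * (T + 1)) F" by (intro tendsto_intros k)
    then have 1: "\<forall>\<^sub>F i in F. k i * (T + 1) < e0" by (rule order_tendstoD) (use e0 in simp)
    have lim: "((\<lambda>i. v i 0 + (v' i 0 - k i * (T + 1)) * (T + 1)) \<longlongrightarrow> c0 + (b0 - 0 * (T + 1)) * (T + 1)) F"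
      by (intro tendsto_intros c b k)
    have "exp (- (T + 1)) < exp (- T)" by simp
    also have "\<dots> = c0 + b0 * T" using T by (simp add: exp_minus field_simps)
    also have "\<dots> \<le> c0 + (b0 - 0 * (T + 1)) * (T + 1)" using b0 by (simp add: algebra_simps)
    finally have 2: "\<forall>\<^sub>F i in F. exp (- (T + 1)) < v i 0 + (v' i 0 - k i * (T + 1)) * (T + 1)"
      by (rule order_tendstoD(1)[OF lim])
    from 1 2 ev_d arc ev_k e0(2) show ?thesis
    proof eventually_elim
      case (elim i)
      interpret bounce_arc "n i" "B i" "v i" "v' i" by (rule elim)
      show ?case
      proof (rule ccontr)
        assume "\<not> ?case"
        then have free: "v i x < (1 - d i) * exp (- x)" if "0 \<le> x" "x \<le> min (B i) X" for x
          using that by fastforce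
        define z where "z = min (B i) (T + 1)"
        have z: "0 < z" "z \<le> B i" "z \<le> X" "z \<le> T + 1" using B_pos T by (auto simp: z_def X_def)
        have "v i 0 + (v' i 0 - k i * (z - 0)) * (z - 0) \<le> v i z" unfolding k_def
          using elim z by (intro free_flight(2)[where z = z]) (auto intro!: less_imp_le[OF free])
        then have low: "v i 0 + (v' i 0 - k i * z) * z \<le> v i z" by simp
        show False
        proof (cases "B i \<le> T + 1")
          case True
          have "k i * z \<le> k i * (T + 1)" using elim z by (intro mult_left_mono) auto
          then have "(v' i 0 - e0) * z \<le> (v' i 0 - k i * z) * z"
            using elim z by (intro mult_right_mono) auto
          moreover have "0 < v i 0 + (v' i 0 - e0) * z" using elim z by blast
          ultimately have "0 < v i z" using low by linarith
          then show False using v_B True by (simp add: z_def)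
        next
          case False
          then have zT: "z = T + 1" by (simp add: z_def)
          have "v i z < (1 - d i) * exp (- z)" using free[of z] z by auto
          also have "\<dots> \<le> 1 * exp (- z)" using elim by (intro mult_right_mono) auto
          finally show False using low elim zT by auto
        qed
      qed
    qed
  qed
  \<comment> \<open>Bundling the conclusions of \<open>bounce_points\<close> into one predicate lets
    \<open>eventually_ex\<close> choose both contact times as functions of the index.\<close>
  define P where "P i a b' \<longleftrightarrow> 0 \<le> a \<and> a \<le> b' \<and> b' < B i \<and> b' \<le> X \<and> (b' - a)\<^sup>2 \<le> 8 * (1 / (1 - d i) - 1) \<and>
    v i a = (1 - d i) * exp (- a) \<and>
    v i 0 + (v' i 0 - k i * a) * a \<le> v i a \<and> v i a \<le> v i 0 + v' i 0 * a \<and>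
    v' i 0 - k i * a \<le> v' i a \<and> v' i a \<le> v' i 0 \<and>
    arc_energy (n i) (v i) (v' i) a \<le> arc_energy (n i) (v i) (v' i) b' \<and>
    arc_energy (n i) (v i) (v' i) b' \<le> arc_energy (n i) (v i) (v' i) a * exp (4 * (b' - a)) \<and>
    (b' < X \<longrightarrow> v i b' = (1 - d i) * exp (- b') \<and> v i b' + v' i b' \<le> 0 \<and>
      (\<forall>x. b' < x \<and> x < min (B i) X \<longrightarrow> v i x \<le> (1 - d i) * exp (- x)))" for i a b'
  have "\<forall>\<^sub>F i in F. \<exists>a b'. P i a b'"
    using small start reach arc ev_d
  proof eventually_elim
    case (elim i)
    interpret bounce_arc "n i" "B i" "v i" "v' i" by (rule elim)
    obtain x0 where x0: "0 \<le> x0" "x0 \<le> min (B i) X" "(1 - d i) * exp (- x0) \<le> v i x0"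
      using elim by blast
    have d: "0 < d i" "d i < 1" and X: "0 < X" using elim T by (auto simp: X_def)
    show ?case unfolding P_def k_def
      by (rule bounce_points[OF elim(1) d elim(2) X x0]) (rule exI, rule exI, intro conjI; assumption)
  qed
  then obtain a b' where P: "\<forall>\<^sub>F i in F. P i (a i) (b' i)" by (auto simp: eventually_ex)
  have aX: "\<forall>\<^sub>F i in F. 0 \<le> a i \<and> a i \<le> X" using P by eventually_elim (auto simp: P_def)
  have ka: "((\<lambda>i. k i * a i) \<longlongrightarrow> 0) F"
  proof (rule tendsto_sandwich[of "\<lambda>_. 0"])
    show "((\<lambda>i. k i * X) \<longlongrightarrow> 0) F" using tendsto_mult_left_zero[OF k] by simp
    show "\<forall>\<^sub>F i in F. 0 \<le> k i * a i" "\<forall>\<^sub>F i in F. k i * a i \<le> k i * X"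
      using aX ev_k by (eventually_elim, auto intro: mult_left_mono)+
  qed auto
  have ba: "((\<lambda>i. b' i - a i) \<longlongrightarrow> 0) F"
  proof (rule tendsto_sandwich[of "\<lambda>_. 0"])
    have "((\<lambda>i. sqrt (8 * (1 / (1 - d i) - 1))) \<longlongrightarrow> sqrt (8 * (1 / (1 - 0) - 1))) F"
      by (intro tendsto_intros d) auto
    then show "((\<lambda>i. sqrt (8 * (1 / (1 - d i) - 1))) \<longlongrightarrow> 0) F" by simp
    show "\<forall>\<^sub>F i in F. 0 \<le> b' i - a i" using P by eventually_elim (simp add: P_def)
    show "\<forall>\<^sub>F i in F. b' i - a i \<le> sqrt (8 * (1 / (1 - d i) - 1))"
      using P by eventually_elim (simp add: P_def real_le_rsqrt)
  qed auto
  have aT: "(a \<longlongrightarrow> T) F"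
  proof -
    \<comment> \<open>The limit contact time solves h T = 1. On [0, \<infinity>) the slope of
      \<open>h\<close> is at least c0 + b0 > 0, so the error of h at \<open>a\<close> controls the
      error of \<open>a\<close>. The bound \<open>r\<close> below collects the errors of the initial
      data, the acceleration \<open>k\<close> and the gap \<open>d\<close>.\<close>
    define h where "h x = (c0 + b0 * x) * exp x" for x
    have mono: "(c0 + b0) * \<bar>x - y\<bar> \<le> \<bar>h x - h y\<bar>" if "0 \<le> x" "0 \<le> y" for x y
    proof -
      have *: "(c0 + b0) * (y - x) \<le> h y - h x" if "0 \<le> x" "x \<le> y" for x y
      proof -
        have "h x - (c0 + b0) * x \<le> h y - (c0 + b0) * y"
        proof (rule DERIV_nonneg_imp_nondecreasing[OF that(2)])
          fix w assume w: "x \<le> w" "w \<le> y"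
          have "c0 + b0 \<le> (c0 + b0 + b0 * w) * 1" using w that b0 by simp
          also have "\<dots> \<le> (c0 + b0 + b0 * w) * exp w" using w that b0 c0 by (intro mult_left_mono) auto
          finally have "0 \<le> (c0 + b0 + b0 * w) * exp w - (c0 + b0)" by simp
          moreover have "((\<lambda>x. h x - (c0 + b0) * x) has_real_derivative (c0 + b0 + b0 * w) * exp w - (c0 + b0)) (at w)"
            unfolding h_def by (auto intro!: derivative_eq_intros simp: algebra_simps)
          ultimately show "\<exists>d. ((\<lambda>x. h x - (c0 + b0) * x) has_real_derivative d) (at w) \<and> 0 \<le> d" by blast
        qed
        then show ?thesis by (simp add: algebra_simps)
      qed
      show ?thesis using *[of x y] *[of y x] that by (cases "x \<le> y") (auto simp: abs_if algebra_simps)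
    qed
    define r where "r i = (exp X * (\<bar>v i 0 - c0\<bar> + \<bar>v' i 0 - b0\<bar> * X + k i * X * X) + d i) / (c0 + b0)" for i
    have "(r \<longlongrightarrow> (exp X * (\<bar>c0 - c0\<bar> + \<bar>b0 - b0\<bar> * X + 0 * X * X) + 0) / (c0 + b0)) F"
      unfolding r_def using cb by (intro tendsto_intros c b k d) auto
    then have r: "(r \<longlongrightarrow> 0) F" by simp
    have "\<forall>\<^sub>F i in F. norm (a i - T) \<le> r i"
      using P aX ev_k ev_d
    proof eventually_elim
      case (elim i)
      have 1: "v i a' * exp a' = 1 - d i" if "a' = a i" for a'
        using elim that by (simp add: P_def exp_minus field_simps)
      have lo: "v i 0 + v' i 0 * a i - k i * a i * a i \<le> v i (a i)" and up: "v i (a i) \<le> v i 0 + v' i 0 * a i"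
        using elim by (auto simp: P_def algebra_simps)
      have k2: "k i * a i * a i \<le> k i * X * X" "0 \<le> k i * a i * a i"
        using elim T by (auto intro!: mult_mono simp: X_def)
      have "\<bar>(v' i 0 - b0) * a i\<bar> \<le> \<bar>v' i 0 - b0\<bar> * X"
        unfolding abs_mult using elim by (intro mult_left_mono) auto
      then have "\<bar>c0 + b0 * a i - v i (a i)\<bar> \<le> \<bar>v i 0 - c0\<bar> + \<bar>v' i 0 - b0\<bar> * X + k i * X * X"
        using lo up k2 by (simp add: algebra_simps)
      moreover have "exp (a i) \<le> exp X" using elim by simp
      ultimately have "exp (a i) * \<bar>c0 + b0 * a i - v i (a i)\<bar> \<le>
          exp X * (\<bar>v i 0 - c0\<bar> + \<bar>v' i 0 - b0\<bar> * X + k i * X * X)"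
        by (intro mult_mono) auto
      moreover have "h (a i) - h T = exp (a i) * (c0 + b0 * a i - v i (a i)) - d i"
        using 1[of "a i"] T by (simp add: h_def algebra_simps)
      ultimately have "\<bar>h (a i) - h T\<bar> \<le> exp X * (\<bar>v i 0 - c0\<bar> + \<bar>v' i 0 - b0\<bar> * X + k i * X * X) + d i"
        using elim abs_triangle_ineq4[of "exp (a i) * (c0 + b0 * a i - v i (a i))" "d i"]
        by (simp add: abs_mult)
      moreover have "(c0 + b0) * \<bar>a i - T\<bar> \<le> \<bar>h (a i) - h T\<bar>" using mono elim T by simp
      ultimately show ?case using cb by (simp add: r_def field_simps)
    qed
    then have "((\<lambda>i. a i - T) \<longlongrightarrow> 0) F" by (rule Lim_null_comparison[OF _ r])
    then show ?thesis by (simp add: LIM_zero_iff)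
  qed
  have bT: "(b' \<longlongrightarrow> T) F" using tendsto_add[OF ba aT] by simp
  have v'a: "((\<lambda>i. v' i (a i)) \<longlongrightarrow> b0) F"
  proof (rule tendsto_sandwich)
    show "((\<lambda>i. v' i 0 - k i * a i) \<longlongrightarrow> b0) F" using tendsto_diff[OF b ka] by simp
    show "((\<lambda>i. v' i 0) \<longlongrightarrow> b0) F" by (rule b)
    show "\<forall>\<^sub>F i in F. v' i 0 - k i * a i \<le> v' i (a i)" "\<forall>\<^sub>F i in F. v' i (a i) \<le> v' i 0"
      using P by (eventually_elim, simp add: P_def)+
  qed
  have dT: "((\<lambda>i. (1 - d i) * exp (- y i)) \<longlongrightarrow> exp (- T)) F" if "(y \<longlongrightarrow> T) F" for y
  proof -
    have "((\<lambda>i. (1 - d i) * exp (- y i)) \<longlongrightarrow> (1 - 0) * exp (- T)) F"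
      by (intro tendsto_intros d that)
    then show ?thesis by simp
  qed
  have va: "((\<lambda>i. v i (a i)) \<longlongrightarrow> exp (- T)) F"
    by (rule Lim_transform_eventually[OF dT[OF aT]]) (use P in eventually_elim, simp add: P_def)
  have bX: "\<forall>\<^sub>F i in F. b' i < X" using bT by (rule order_tendstoD) (simp add: X_def)
  have vb: "((\<lambda>i. v i (b' i)) \<longlongrightarrow> exp (- T)) F"
    by (rule Lim_transform_eventually[OF dT[OF bT]]) (use P bX in eventually_elim, simp add: P_def)
  \<comment> \<open>\<open>wa\<close> and \<open>wb\<close> are \<phi>' on entering and on leaving
    the contact. Both ends lie on the level \<phi> = 1 - d, so the potential \<open>pot\<close> is
    the same there; it vanishes in the limit because (1 - 1 / sqrt n)^n decays faster than any power
    of n.\<close>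
  define wa where "wa i = exp (a i) * (v i (a i) + v' i (a i))" for i
  define wb where "wb i = exp (b' i) * (v i (b' i) + v' i (b' i))" for i
  define Ea where "Ea i = arc_energy (n i) (v i) (v' i) (a i)" for i
  define Eb where "Eb i = arc_energy (n i) (v i) (v' i) (b' i)" for i
  define pot where "pot i = (n i)\<^sup>2 / (4 * (n i + 2)) * (1 - d i) powr (n i + 2)" for i
  have "(wa \<longlongrightarrow> exp T * (exp (- T) + b0)) F" unfolding wa_def
    by (intro tendsto_intros aT va v'a)
  then have wa: "(wa \<longlongrightarrow> s) F" by (simp add: s_def exp_minus distrib_left mult.commute)
  have pot: "(pot \<longlongrightarrow> 0) F" unfolding pot_def d_def
    by (rule filterlim_compose[OF _ n]) real_asymp
  have "\<forall>\<^sub>F i in F. exp (a i) * v i (a i) = 1 - d i"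
    using P by eventually_elim (simp add: P_def exp_minus)
  then have Ea_eq: "\<forall>\<^sub>F i in F. Ea i = (wa i)\<^sup>2 / 2 + (1 - d i)\<^sup>2 / 2 + pot i"
    by eventually_elim (simp add: Ea_def arc_energy_def wa_def pot_def)
  have "\<forall>\<^sub>F i in F. exp (b' i) * v i (b' i) = 1 - d i"
    using P bX by eventually_elim (simp add: P_def exp_minus)
  then have Eb_eq: "\<forall>\<^sub>F i in F. Eb i = (wb i)\<^sup>2 / 2 + (1 - d i)\<^sup>2 / 2 + pot i"
    by eventually_elim (simp add: Eb_def arc_energy_def wb_def pot_def)
  have "((\<lambda>i. (wa i)\<^sup>2 / 2 + (1 - d i)\<^sup>2 / 2 + pot i) \<longlongrightarrow> s\<^sup>2 / 2 + (1 - 0)\<^sup>2 / 2 + 0) F"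
    by (intro tendsto_intros wa d pot) auto
  then have Ea: "(Ea \<longlongrightarrow> s\<^sup>2 / 2 + 1 / 2) F"
    using tendsto_cong[OF Ea_eq] by simp
  have Eba: "(Eb \<longlongrightarrow> s\<^sup>2 / 2 + 1 / 2) F"
  proof (rule tendsto_sandwich[OF _ _ Ea])
    have "((\<lambda>i. Ea i * exp (4 * (b' i - a i))) \<longlongrightarrow> (s\<^sup>2 / 2 + 1 / 2) * exp (4 * 0)) F"
      by (intro tendsto_intros Ea ba)
    then show "((\<lambda>i. Ea i * exp (4 * (b' i - a i))) \<longlongrightarrow> s\<^sup>2 / 2 + 1 / 2) F" by simp
    show "\<forall>\<^sub>F i in F. Ea i \<le> Eb i" "\<forall>\<^sub>F i in F. Eb i \<le> Ea i * exp (4 * (b' i - a i))"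
      using P by (eventually_elim, simp add: P_def Ea_def Eb_def)+
  qed
  \<comment> \<open>The energy determines only the square of \<open>wb\<close>; the sign comes from
    v + v' <= 0 at the last contact. This is the elastic reflection.\<close>
  have wb: "(wb \<longlongrightarrow> - s) F"
  proof -
    have "((\<lambda>i. - sqrt (2 * Eb i - (1 - d i)\<^sup>2 - 2 * pot i)) \<longlongrightarrow>
        - sqrt (2 * (s\<^sup>2 / 2 + 1 / 2) - (1 - 0)\<^sup>2 - 2 * 0)) F"
      by (intro tendsto_intros Eba d pot)
    then have "((\<lambda>i. - sqrt (2 * Eb i - (1 - d i)\<^sup>2 - 2 * pot i)) \<longlongrightarrow> - s) F" using s1 by simp
    moreover have "\<forall>\<^sub>F i in F. - sqrt (2 * Eb i - (1 - d i)\<^sup>2 - 2 * pot i) = wb i"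
      using P bX Eb_eq
    proof eventually_elim
      case (elim i)
      have "wb i \<le> 0" using elim by (auto simp: P_def wb_def intro!: mult_nonneg_nonpos)
      moreover have "2 * Eb i - (1 - d i)\<^sup>2 - 2 * pot i = (wb i)\<^sup>2" using elim by simp
      ultimately show ?case by simp
    qed
    ultimately show ?thesis by (rule Lim_transform_eventually)
  qed
  have v'b: "((\<lambda>i. v' i (b' i)) \<longlongrightarrow> - ((1 + s) * exp (- T))) F"
  proof -
    have "((\<lambda>i. exp (- b' i) * wb i - v i (b' i)) \<longlongrightarrow> exp (- T) * (- s) - exp (- T)) F"
      by (intro tendsto_intros bT wb vb)
    moreover have "exp (- b' i) * wb i - v i (b' i) = v' i (b' i)" for i
      by (simp add: wb_def exp_minus mult.assoc[symmetric])
    moreover have "exp (- T) * (- s) - exp (- T) = - ((1 + s) * exp (- T))" by (simp add: algebra_simps)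
    ultimately show ?thesis by (simp only:)
  qed
  \<comment> \<open>By concavity v lies below its tangent at \<open>b'\<close>, which in the limit
    falls from exp (- T) to 0 within time 1 / (1 + s) <= 1/2 and is negative at T + 2.\<close>
  have BX: "\<forall>\<^sub>F i in F. B i \<le> X"
  proof -
    have lim: "((\<lambda>i. v i (b' i) + v' i (b' i) * (X - b' i)) \<longlongrightarrow> exp (- T) + - ((1 + s) * exp (- T)) * (X - T)) F"
      by (intro tendsto_intros vb v'b bT)
    have "exp (- T) + - ((1 + s) * exp (- T)) * (X - T) = exp (- T) * (1 - (1 + s) * 2)"
      by (simp add: X_def algebra_simps)
    also have "\<dots> < 0" using s1 by (intro mult_pos_neg) auto
    finally have "\<forall>\<^sub>F i in F. v i (b' i) + v' i (b' i) * (X - b' i) < 0"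
      by (rule order_tendstoD(2)[OF lim])
    then show ?thesis using P bX arc ev_d
    proof eventually_elim
      case (elim i)
      interpret bounce_arc "n i" "B i" "v i" "v' i" by (rule elim)
      show ?case
      proof (rule ccontr)
        assume "\<not> ?case"
        then have X: "X < B i" by simp
        have "v i X \<le> v i (b' i) + v' i (b' i) * (X - b' i)"
          using elim X by (intro free_flight(3)[where d = "d i" and z = X]) (auto simp: P_def)
        moreover have "0 < v i X" using v_pos X T by (auto simp: X_def)
        ultimately show False using elim by simp
      qed
    qed
  qed
  \<comment> \<open>After the last contact the flight is free up to \<open>B\<close>. Inserting v B
    = 0 into its two linear bounds encloses B - b', and v' hardly changes on the way.\<close>
  have final: "\<forall>\<^sub>F i in F. 0 \<le> v i (b' i) + v' i (b' i) * (B i - b' i) \<and>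
      v i (b' i) + v' i (b' i) * (B i - b' i) \<le> k i * X * X \<and> b' i < B i \<and>
      (\<forall>x. b' i < x \<and> x < B i \<longrightarrow> v' i (b' i) - k i * X \<le> v' i x \<and> v' i x \<le> v' i (b' i))"
    using P bX BX arc ev_d ev_k
  proof eventually_elim
    case (elim i)
    interpret bounce_arc "n i" "B i" "v i" "v' i" by (rule elim)
    have b': "0 \<le> b' i" "b' i < B i" using elim by (auto simp: P_def)
    have d: "0 < d i" "d i < 1" using elim by auto
    note fl = free_flight[OF d, of "b' i" "B i", folded k_def]
    have free: "\<And>x. b' i < x \<Longrightarrow> x < B i \<Longrightarrow> v i x \<le> (1 - d i) * exp (- x)"
      using elim by (auto simp: P_def)
    have "v i (B i) \<le> v i (b' i) + v' i (b' i) * (B i - b' i)"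
      using b' free by (intro fl(3)) auto
    moreover have "v i (b' i) + (v' i (b' i) - k i * (B i - b' i)) * (B i - b' i) \<le> v i (B i)"
      using b' free by (intro fl(2)) auto
    then have "v i (b' i) + v' i (b' i) * (B i - b' i) \<le> k i * (B i - b' i) * (B i - b' i)"
      by (simp add: v_B algebra_simps)
    moreover have "k i * (B i - b' i) * (B i - b' i) \<le> k i * X * X"
      using b' elim T by (intro mult_mono) (auto simp: X_def)
    moreover have "v' i (b' i) - k i * X \<le> v' i x \<and> v' i x \<le> v' i (b' i)" if x: "b' i < x" "x < B i" for x
    proof
      have "v' i (b' i) - k i * (x - b' i) \<le> v' i x" using b' free x by (intro fl(1)) auto
      moreover have "k i * (x - b' i) \<le> k i * X" using elim x b' by (intro mult_left_mono) auto
      ultimately show "v' i (b' i) - k i * X \<le> v' i x" by linarith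
      show "v' i x \<le> v' i (b' i)" using v'_antimono[of "b' i" x] b' x by simp
    qed
    ultimately show ?case using v_B b' by auto
  qed
  have kX: "((\<lambda>i. k i * X) \<longlongrightarrow> 0) F" "((\<lambda>i. k i * X * X) \<longlongrightarrow> 0) F"
    using tendsto_mult_left_zero[OF k] tendsto_mult_left_zero[OF tendsto_mult_left_zero[OF k]] by auto
  have neg: "- ((1 + s) * exp (- T)) < 0" using s1 by simp
  have ev_neg: "\<forall>\<^sub>F i in F. v' i (b' i) < 0" by (rule order_tendstoD(2)[OF v'b neg])
  have "((\<lambda>i. B i - b' i) \<longlongrightarrow> 1 / (1 + s)) F"
  proof (rule tendsto_sandwich)
    show "\<forall>\<^sub>F i in F. (v i (b' i) - k i * X * X) / - v' i (b' i) \<le> B i - b' i"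
      using final ev_neg by eventually_elim (subst pos_divide_le_eq, auto simp: algebra_simps)
    show "\<forall>\<^sub>F i in F. B i - b' i \<le> v i (b' i) / - v' i (b' i)"
      using final ev_neg by eventually_elim (subst pos_le_divide_eq, auto simp: algebra_simps)
    have eq: "exp (- T) / - (- ((1 + s) * exp (- T))) = 1 / (1 + s)"
      using s1 by simp
    have "((\<lambda>i. v i (b' i) / - v' i (b' i)) \<longlongrightarrow> exp (- T) / - (- ((1 + s) * exp (- T)))) F"
      using neg by (intro tendsto_intros vb v'b) auto
    then show "((\<lambda>i. v i (b' i) / - v' i (b' i)) \<longlongrightarrow> 1 / (1 + s)) F" by (simp only: eq)
    have "((\<lambda>i. (v i (b' i) - k i * X * X) / - v' i (b' i)) \<longlongrightarrow> (exp (- T) - 0) / - (- ((1 + s) * exp (- T)))) F"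
      using neg by (intro tendsto_intros vb v'b kX) auto
    then show "((\<lambda>i. (v i (b' i) - k i * X * X) / - v' i (b' i)) \<longlongrightarrow> 1 / (1 + s)) F" by (simp only: eq diff_zero)
  qed
  from tendsto_add[OF this bT] show "(B \<longlongrightarrow> T + 1 / (1 + s)) F" by (simp add: add.commute)
  show "\<forall>\<^sub>F i in F. \<exists>y < B i. \<forall>x. y < x \<and> x < B i \<longrightarrow> \<bar>v' i x + (1 + s) * exp (- T)\<bar> < e" if "0 < e" for e
  proof -
    have "((\<lambda>i. v' i (b' i) - k i * X) \<longlongrightarrow> - ((1 + s) * exp (- T)) - 0) F"
      by (intro tendsto_intros v'b kX)
    then have "\<forall>\<^sub>F i in F. - ((1 + s) * exp (- T)) - e < v' i (b' i) - k i * X"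
      by (rule order_tendstoD) (use that in simp)
    moreover have "\<forall>\<^sub>F i in F. v' i (b' i) < - ((1 + s) * exp (- T)) + e"
      by (rule order_tendstoD[OF v'b]) (use that in simp)
    ultimately show ?thesis using final
    proof eventually_elim
      case (elim i)
      then show ?case by (intro exI[of _ "b' i"]) (force simp: abs_less_iff)
    qed
  qed
qed

section \<open>Radial weak solutions\<close>

text \<open>The density \<pi> is the area of a disc as a function of its squared radius. The minus
  sign makes the half-lines {a<..} pull back to bounded discs, so that they have finite measure as
  \<open>measure_eqI_lessThan\<close> demands.\<close>

lemma distr_neg_inner_self:
  "distr lborel borel (\<lambda>x::R2. - (x \<bullet> x)) = density lborel (\<lambda>t. ennreal (pi * indicator {..0} t))"
proof (rule measure_eqI_lessThan)
  fix a :: real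
  have "emeasure (distr lborel borel (\<lambda>x::R2. - (x \<bullet> x))) {a<..} = emeasure lborel {x::R2. x \<bullet> x < - a}"
    by (subst emeasure_distr) (auto simp: vimage_def less_minus_iff)
  also have "\<dots> = ennreal (pi * max 0 (- a))"
  proof (cases "a < 0")
    case True
    have "{x::R2. x \<bullet> x < - a} = ball 0 (sqrt (- a))"
      by (auto simp: norm_eq_sqrt_inner)
    then show ?thesis using True emeasure_ball[of "sqrt (- a)" "0::R2"]
      by (simp add: unit_ball_vol_2)
  next
    case False
    have "\<not> x \<bullet> x < - a" for x :: R2 using False inner_ge_zero[of x] by linarith
    then have "{x::R2. x \<bullet> x < - a} = {}" by simp
    then show ?thesis using False by simp
  qed
  finally have 1: "emeasure (distr lborel borel (\<lambda>x::R2. - (x \<bullet> x))) {a<..} = ennreal (pi * max 0 (- a))" .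
  then show "emeasure (distr lborel borel (\<lambda>x::R2. - (x \<bullet> x))) {a<..} < \<infinity>" by simp
  have "emeasure (density lborel (\<lambda>t. ennreal (pi * indicator {..0} t))) {a<..}
      = (\<integral>\<^sup>+ t. ennreal pi * indicator {a<..0} t \<partial>lborel)"
    by (subst emeasure_density) (auto intro!: nn_integral_cong simp: indicator_def)
  also have "\<dots> = ennreal (pi * max 0 (- a))"
    by (cases "a \<le> 0") (auto simp: nn_integral_cmult simp flip: ennreal_mult)
  finally show "emeasure (distr lborel borel (\<lambda>x::R2. - (x \<bullet> x))) {a<..} =
      emeasure (density lborel (\<lambda>t. ennreal (pi * indicator {..0} t))) {a<..}" using 1 by simp
qed auto

text \<open>The excepted point t = b is a null set; it allows an \<open>f\<close> that jumps at the
  right end, as for a function cut off at the unit sphere.\<close>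

lemma integral_inner_self:
  fixes f g :: "real \<Rightarrow> real"
  assumes f[measurable]: "f \<in> borel_measurable borel" and "0 \<le> a" and g: "continuous_on {a..b} g"
    and eq: "\<And>t. 0 \<le> t \<Longrightarrow> t \<noteq> b \<Longrightarrow> f t = (if t \<in> {a..b} then g t else 0)"
  shows "(LINT x|lborel. f ((x::R2) \<bullet> x)) = pi * integral {a..b} g"
proof -
  have "(LINT x|lborel. f ((x::R2) \<bullet> x)) = (LINT t|distr lborel borel (\<lambda>x::R2. - (x \<bullet> x)). f (- t))"
    by (subst integral_distr) auto
  also have "\<dots> = (LINT t|lborel. (pi * indicator {..0} t) *\<^sub>R f (- t))"
    unfolding distr_neg_inner_self by (subst integral_density) auto
  also have "\<dots> = (LINT t|lborel. (pi * indicator {..0} (- t)) *\<^sub>R f t)"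
    by (subst lborel_integral_real_affine[of "-1" _ 0]) auto
  also have "\<dots> = (LINT t|lborel. pi * (indicator {a..b} t *\<^sub>R g t))"
  proof (rule integral_cong_AE)
    have "(\<lambda>t. indicator {a..b} t *\<^sub>R g t) \<in> borel_measurable lborel"
      using borel_integrable_compact[OF compact_Icc g] by (rule borel_measurable_integrable)
    then show "(\<lambda>t. pi * (indicator {a..b} t *\<^sub>R g t)) \<in> borel_measurable lborel" by measurable
    show "AE t in lborel. (pi * indicator {..0} (- t)) *\<^sub>R f t = pi * (indicator {a..b} t *\<^sub>R g t)"
      using AE_lborel_singleton[of b]
    proof eventually_elim
      case (elim t)
      then show ?case using eq[of t] \<open>0 \<le> a\<close> by (auto simp: indicator_def)
    qed
  qed auto
  also have "\<dots> = pi * (LINT t:{a..b}|lborel. g t)" by (simp add: set_lebesgue_integral_def)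
  also have "(LINT t:{a..b}|lborel. g t) = integral {a..b} g"
    by (rule set_borel_integral_eq_integral)
      (use borel_integrable_compact[OF compact_Icc g] in \<open>simp add: set_integrable_def\<close>)
  finally show ?thesis .
qed

text \<open>Test with k = (P - c) w, where the weight w is positive inside and vanishes at the ends,
  and c is the w-weighted mean of P, so that k has mean zero. The result is that (P - c)^2 w has
  integral 0.\<close>

lemma du_Bois_Reymond:
  fixes P :: "real \<Rightarrow> real"
  assumes "a < b" and P: "continuous_on {a..b} P"
    and orth: "\<And>k. continuous_on UNIV k \<Longrightarrow> (\<And>t. t \<notin> {a..b} \<Longrightarrow> k t = 0) \<Longrightarrow>
      integral {a..b} k = 0 \<Longrightarrow> integral {a..b} (\<lambda>t. P t * k t) = 0"
  shows "\<exists>c. \<forall>t. a < t \<and> t < b \<longrightarrow> P t = c"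
proof -
  define w where "w t = max 0 ((t - a) * (b - t))" for t
  define c where "c = integral {a..b} (\<lambda>t. P t * w t) / integral {a..b} w"
  \<comment> \<open>Clamping the argument to [a, b] makes \<open>k\<close> continuous on the whole
    line, although P is controlled only on [a, b].\<close>
  define k where "k t = (P (max a (min b t)) - c) * w t" for t
  have w: "continuous_on S w" for S unfolding w_def by (intro continuous_intros)
  have w0: "0 \<le> w t" for t by (simp add: w_def)
  have wp: "0 < w t" if "a < t" "t < b" for t using that by (simp add: w_def)
  have wi: "w integrable_on {a..b}" by (intro integrable_continuous_real w)
  have "integral {a..b} w \<noteq> 0"
  proof
    assume "integral {a..b} w = 0"
    then have "\<forall>t\<in>{a..b}. w t = 0"
      using integral_eq_0_iff[of a b w] w w0 \<open>a < b\<close> by auto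
    then show False using wp[of "(a + b) / 2"] \<open>a < b\<close> by auto
  qed
  moreover have Pw: "(\<lambda>t. P t * w t) integrable_on {a..b}"
    by (intro integrable_continuous_real continuous_intros P w)
  moreover have "integral {a..b} k = integral {a..b} (\<lambda>t. P t * w t - c * w t)"
    by (rule integral_cong) (auto simp: k_def algebra_simps min_def max_def)
  moreover have "\<dots> = integral {a..b} (\<lambda>t. P t * w t) - c * integral {a..b} w"
    using wi Pw by (subst integral_diff) (auto intro: integrable_on_mult_right)
  ultimately have k0: "integral {a..b} k = 0" by (simp add: c_def)
  have kc: "continuous_on UNIV k"
    unfolding k_def using \<open>a < b\<close>
    by (intro continuous_intros w continuous_on_compose2[OF P]) auto
  have "k t = 0" if "t \<notin> {a..b}" for t
  proof -
    have "(t - a) * (b - t) \<le> 0" using that \<open>a < b\<close>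
      by (auto simp: mult_le_0_iff)
    then show ?thesis by (simp add: k_def w_def)
  qed
  then have "integral {a..b} (\<lambda>t. P t * k t) = 0" using orth kc k0 by blast
  moreover have "integral {a..b} (\<lambda>t. (P t - c) * k t) = integral {a..b} (\<lambda>t. P t * k t) - c * integral {a..b} k"
    using continuous_on_subset[OF kc]
    by (subst integral_mult_right[symmetric], subst integral_diff[symmetric])
      (auto intro!: integrable_continuous_real continuous_intros P simp: algebra_simps)
  ultimately have "integral {a..b} (\<lambda>t. (P t - c) * k t) = 0" using k0 by simp
  also have "integral {a..b} (\<lambda>t. (P t - c) * k t) = integral {a..b} (\<lambda>t. (P t - c)\<^sup>2 * w t)"
    by (rule integral_cong) (auto simp: k_def power2_eq_square min_def max_def)
  finally have "integral {a..b} (\<lambda>t. (P t - c)\<^sup>2 * w t) = 0" .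
  then have *: "\<forall>t\<in>{a..b}. (P t - c)\<^sup>2 * w t = 0"
    using w0 \<open>a < b\<close> by (subst (asm) integral_eq_0_iff) (auto intro!: continuous_intros P w)
  have "P t = c" if "a < t" "t < b" for t
    using *[rule_format, of t] that wp[OF that] by auto
  then show ?thesis by blast
qed

section \<open>Radial test functions and radial vector fields\<close>

lemma antiderivative_UNIV:
  fixes f :: "real \<Rightarrow> real"
  assumes "continuous_on UNIV f"
  shows "\<exists>F. \<forall>x. (F has_real_derivative f x) (at x)"
proof -
  have "\<exists>F. \<forall>x::real. - \<infinity> < ereal x \<longrightarrow> ereal x < \<infinity> \<longrightarrow> (F has_vector_derivative f x) (at x)"
    using assms by (intro einterval_antiderivative) (auto simp: continuous_on_eq_continuous_at)
  then show ?thesis by (auto simp: has_real_derivative_iff_has_vector_derivative)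
qed

lemma support_inner_self:
  fixes h :: "R2 \<Rightarrow> real"
  assumes "\<And>x. c \<le> x \<bullet> x \<Longrightarrow> h x = 0"
  shows "compact (closure {x. h x \<noteq> 0})" "closure {x. h x \<noteq> 0} \<subseteq> cball 0 (sqrt c)"
proof -
  have "{x. h x \<noteq> 0} \<subseteq> cball 0 (sqrt c)"
    using assms by (force simp: norm_eq_sqrt_inner)
  then show *: "closure {x. h x \<noteq> 0} \<subseteq> cball 0 (sqrt c)"
    by (simp add: closure_minimal)
  then show "compact (closure {x. h x \<noteq> 0})"
    by (meson bounded_cball bounded_subset closed_closure compact_eq_bounded_closed)
qed

lemma has_derivative_inner_self:
  fixes P P' :: "real \<Rightarrow> real"
  assumes "\<And>t. (P has_real_derivative P' t) (at t)"
  shows "((\<lambda>x::R2. P (x \<bullet> x)) has_derivative (\<lambda>h. (2 * P' (x \<bullet> x)) *\<^sub>R x \<bullet> h)) (at x)"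
proof -
  have "((\<lambda>x::R2. x \<bullet> x) has_derivative (\<lambda>h. x \<bullet> h + h \<bullet> x)) (at x)"
    by (auto intro!: derivative_eq_intros)
  from has_derivative_compose[OF this, of P "(*) (P' (x \<bullet> x))"] assms[of "x \<bullet> x"]
  show ?thesis by (simp add: has_field_derivative_def inner_commute algebra_simps)
qed

lemma continuous_comp_inner_self:
  fixes P :: "real \<Rightarrow> real"
  assumes "continuous_on UNIV P"
  shows "continuous_on S (\<lambda>x::R2. P (x \<bullet> x))"
  by (rule continuous_on_compose2[OF assms]) (auto intro!: continuous_intros)

lemma deriv_continuous_UNIV:
  fixes P P' :: "real \<Rightarrow> real"
  assumes "\<And>t. (P has_real_derivative P' t) (at t)"
  shows "continuous_on UNIV P"
  by (intro continuous_at_imp_continuous_on ballI DERIV_isCont[OF assms])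

lemma test_fun_radial:
  assumes d: "\<And>t. (P has_real_derivative P' t) (at t)" and c: "continuous_on UNIV P'"
    and z: "\<And>t. b \<le> t \<Longrightarrow> P t = 0" and b: "b < 1"
  shows "test_fun unit_ball (\<lambda>x. P (x \<bullet> x)) (\<lambda>x. (2 * P' (x \<bullet> x)) *\<^sub>R x)"
proof -
  have "sqrt b < 1" using b by simp
  then have "cball 0 (sqrt b) \<subseteq> (ball 0 1 :: R2 set)" by (auto simp del: real_sqrt_lt_1_iff)
  then have "closure {x::R2. P (x \<bullet> x) \<noteq> 0} \<subseteq> unit_ball" "compact (closure {x::R2. P (x \<bullet> x) \<noteq> 0})"
    using support_inner_self[of b "\<lambda>x. P (x \<bullet> x)"] z by (auto simp: unit_ball_def)
  moreover have "continuous_on UNIV (\<lambda>x::R2. (2 * P' (x \<bullet> x)) *\<^sub>R x)"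
    by (intro continuous_intros continuous_comp_inner_self c)
  ultimately show ?thesis
    unfolding test_fun_def using has_derivative_inner_self[of P P', OF d] by blast
qed

text \<open>One component of the field P(|x|^2) x, because \<open>weak_gradient\<close> is tested
  one partial derivative at a time; the divergence appears on summing over \<open>i\<close>. The
  support may leave the ball, which is what gives access to the boundary values.\<close>

lemma test_fun_radial_nth:
  assumes d: "\<And>t. (P has_real_derivative P' t) (at t)" and c: "continuous_on UNIV P'"
    and z: "\<And>t. b \<le> t \<Longrightarrow> P t = 0"
  shows "test_fun UNIV (\<lambda>x. P (x \<bullet> x) * x $ i)
    (\<lambda>x. (2 * P' (x \<bullet> x) * x $ i) *\<^sub>R x + P (x \<bullet> x) *\<^sub>R axis i 1)"
proof -
  have nth: "((\<lambda>x::R2. x $ i) has_derivative (\<lambda>h. h $ i)) (at x)" for x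
    by (rule bounded_linear_imp_has_derivative) (rule bounded_linear_vec_nth)
  have "((\<lambda>x::R2. P (x \<bullet> x) * x $ i) has_derivative
      (\<lambda>h. ((2 * P' (x \<bullet> x) * x $ i) *\<^sub>R x + P (x \<bullet> x) *\<^sub>R axis i 1) \<bullet> h)) (at x)" for x
    by (rule has_derivative_eq_rhs, rule has_derivative_mult[OF has_derivative_inner_self[of P P', OF d] nth])
      (auto simp: inner_add_left inner_axis' algebra_simps)
  moreover have "continuous_on UNIV (\<lambda>x. (2 * P' (x \<bullet> x) * x $ i) *\<^sub>R x + P (x \<bullet> x) *\<^sub>R axis i 1)"
    by (intro continuous_intros continuous_comp_inner_self c deriv_continuous_UNIV[of P P', OF d])
  moreover have "compact (closure {x. P (x \<bullet> x) * x $ i \<noteq> 0})"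
    by (rule support_inner_self[of b]) (simp add: z)
  ultimately show ?thesis
    unfolding test_fun_def by simp
qed

lemma integrable_L2_mult_test:
  fixes h w :: "R2 \<Rightarrow> real"
  assumes [measurable]: "h \<in> borel_measurable lborel" and h: "integrable lborel (\<lambda>x. (h x)\<^sup>2)"
    and w: "continuous_on UNIV w" and z: "\<And>x. c \<le> x \<bullet> x \<Longrightarrow> w x = 0"
  shows "integrable lborel (\<lambda>x. h x * w x)"
proof (rule Bochner_Integration.integrable_bound)
  have [measurable]: "w \<in> borel_measurable lborel" using w by (simp add: borel_measurable_continuous_onI)
  have "integrable lborel (\<lambda>x. indicator (cball 0 (sqrt c)) x *\<^sub>R (w x)\<^sup>2)"
    by (intro borel_integrable_compact compact_cball continuous_intros continuous_on_subset[OF w]) auto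
  also have "(\<lambda>x. indicator (cball 0 (sqrt c)) x *\<^sub>R (w x)\<^sup>2) = (\<lambda>x. (w x)\<^sup>2)"
    using z by (fastforce simp: indicator_def norm_eq_sqrt_inner)
  finally show "integrable lborel (\<lambda>x. (h x)\<^sup>2 + (w x)\<^sup>2)" using h by simp
  show "(\<lambda>x. h x * w x) \<in> borel_measurable lborel" by measurable
  have "\<bar>h x * w x\<bar> \<le> (h x)\<^sup>2 + (w x)\<^sup>2" for x
    using sum_squares_bound[of "\<bar>h x\<bar>" "\<bar>w x\<bar>"] mult_nonneg_nonneg[of "\<bar>h x\<bar>" "\<bar>w x\<bar>"]
    unfolding abs_mult power2_abs by linarith
  then show "AE x in lborel. norm (h x * w x) \<le> norm ((h x)\<^sup>2 + (w x)\<^sup>2)" by simp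
qed

lemma H10_wgrad: "H10 u \<Longrightarrow> weak_gradient u (wgrad u)"
  unfolding H10_def wgrad_def by (blast intro: someI_ex[of "weak_gradient u"])

text \<open>Testing the weak gradient with the radial vector field \<open>P(|x|\<^sup>2) x\<close>, whose divergence is \<open>2 (t P(t))'\<close> at \<open>t = |x|\<^sup>2\<close>.\<close>
lemma weak_gradient_radial_field:
  assumes u: "H10 u" and d: "\<And>t. (P has_real_derivative P' t) (at t)" and c: "continuous_on UNIV P'"
    and z: "\<And>t. b \<le> t \<Longrightarrow> P t = 0"
  shows "integrable lborel (\<lambda>x. P (x \<bullet> x) * (wgrad u x \<bullet> x))"
    and "integrable lborel (\<lambda>x. u x * (2 * (P (x \<bullet> x) + (x \<bullet> x) * P' (x \<bullet> x))))"
    and "(LINT x|lborel. u x * (2 * (P (x \<bullet> x) + (x \<bullet> x) * P' (x \<bullet> x)))) =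
      - (LINT x|lborel. P (x \<bullet> x) * (wgrad u x \<bullet> x))"
proof -
  define g where "g = wgrad u"
  have wg: "weak_gradient u g" using H10_wgrad[OF u] by (simp add: g_def)
  have um: "u \<in> borel_measurable lborel" "integrable lborel (\<lambda>x. (u x)\<^sup>2)" using u by (auto simp: H10_def)
  have gm[measurable]: "g \<in> borel_measurable lborel" and gi: "integrable lborel (\<lambda>x. (g x $ i)\<^sup>2)" for i
    using wg by (auto simp: weak_gradient_def)
  have gmi: "(\<lambda>x. g x $ i) \<in> borel_measurable lborel" for i
    using borel_measurable_inner[OF gm borel_measurable_const[of "axis i 1"]] by (simp add: inner_axis)
  have Pc: "continuous_on UNIV P" by (rule deriv_continuous_UNIV[of P P', OF d])
  have P'0: "P' t = 0" if "b + 1 \<le> t" for t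
  proof -
    have "((\<lambda>_. 0) has_real_derivative P' t) (at t)"
      using d[of t] by (rule has_field_derivative_transform_within_open[of _ _ _ "{b<..}"]) (use that z in auto)
    then show ?thesis using DERIV_unique[of "\<lambda>_. 0"] DERIV_const by blast
  qed
  define G where "G i x = (2 * P' (x \<bullet> x) * x $ i) *\<^sub>R x + P (x \<bullet> x) *\<^sub>R axis i 1" for i and x :: R2
  have id: "(LINT x|lborel. u x * (G i x $ i)) = - (LINT x|lborel. (g x $ i) * (P (x \<bullet> x) * x $ i))" for i
    using wg test_fun_radial_nth[OF d c z, of b i] unfolding weak_gradient_def G_def by blast
  have i1: "integrable lborel (\<lambda>x. (g x $ i) * (P (x \<bullet> x) * x $ i))" for i
    by (rule integrable_L2_mult_test[OF gmi gi, of _ b])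
      (auto intro!: continuous_intros continuous_comp_inner_self Pc simp: z)
  have Gi: "G i x $ i = 2 * P' (x \<bullet> x) * (x $ i * x $ i) + P (x \<bullet> x)" for i x
    by (simp add: G_def axis_def)
  have i2: "integrable lborel (\<lambda>x. u x * (G i x $ i))" for i
    unfolding Gi by (rule integrable_L2_mult_test[OF um, of _ "b + 1"])
      (auto intro!: continuous_intros continuous_comp_inner_self Pc c simp: z P'0)
  have s1: "(\<Sum>i\<in>UNIV. (g x $ i) * (P (x \<bullet> x) * x $ i)) = P (x \<bullet> x) * (g x \<bullet> x)" for x
    unfolding inner_vec_def[of "g x" x] by (simp add: sum_distrib_left mult.left_commute)
  have s2: "(\<Sum>i\<in>UNIV. u x * (G i x $ i)) = u x * (2 * (P (x \<bullet> x) + (x \<bullet> x) * P' (x \<bullet> x)))" for x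
  proof -
    have "(\<Sum>i\<in>UNIV. G i x $ i) = 2 * P' (x \<bullet> x) * (x \<bullet> x) + 2 * P (x \<bullet> x)"
      unfolding Gi sum.distrib by (simp add: inner_vec_def sum_distrib_left)
    then show ?thesis by (simp add: algebra_simps flip: sum_distrib_left)
  qed
  have "integrable lborel (\<lambda>x. \<Sum>i\<in>UNIV. (g x $ i) * (P (x \<bullet> x) * x $ i))" using i1 by simp
  then show "integrable lborel (\<lambda>x. P (x \<bullet> x) * (wgrad u x \<bullet> x))" unfolding s1 by (simp add: g_def)
  have "integrable lborel (\<lambda>x. \<Sum>i\<in>UNIV. u x * (G i x $ i))" using i2 by simp
  then show "integrable lborel (\<lambda>x. u x * (2 * (P (x \<bullet> x) + (x \<bullet> x) * P' (x \<bullet> x))))" unfolding s2 .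
  have "(LINT x|lborel. (\<Sum>i\<in>UNIV. u x * (G i x $ i))) = - (LINT x|lborel. (\<Sum>i\<in>UNIV. (g x $ i) * (P (x \<bullet> x) * x $ i)))"
    using i1 i2 id by (simp add: sum_negf)
  then show "(LINT x|lborel. u x * (2 * (P (x \<bullet> x) + (x \<bullet> x) * P' (x \<bullet> x)))) =
      - (LINT x|lborel. P (x \<bullet> x) * (wgrad u x \<bullet> x))" unfolding s1 s2 by (simp add: g_def)
qed

section \<open>The profile and its differential equation\<close>

text \<open>The radial profile is parametrised by \<open>t = |x|\<^sup>2\<close>, a variable in which planar measure has the constant density \<open>\<pi>\<close>.\<close>
definition profile :: "(R2 \<Rightarrow> real) \<Rightarrow> real \<Rightarrow> real" where
  "profile u t = u (sqrt t *\<^sub>R axis 1 1)"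

lemma profile_inner:
  assumes "radial u"
  shows "profile u (x \<bullet> x) = u x"
proof -
  have "norm (sqrt (x \<bullet> x) *\<^sub>R axis 1 1 :: R2) = norm x"
    by (simp add: norm_axis_1 norm_eq_sqrt_inner[of x])
  then show ?thesis using assms unfolding profile_def radial_def by blast
qed

lemma profile_measurable:
  assumes "u \<in> borel_measurable lborel"
  shows "profile u \<in> borel_measurable borel"
proof -
  have "(\<lambda>t. sqrt t *\<^sub>R axis 1 1 :: R2) \<in> borel \<rightarrow>\<^sub>M borel"
    by (intro borel_measurable_continuous_onI continuous_intros)
  moreover have "u \<in> borel \<rightarrow>\<^sub>M borel" using assms by simp
  ultimately have "(\<lambda>t. u (sqrt t *\<^sub>R axis 1 1)) \<in> borel \<rightarrow>\<^sub>M borel" by (rule measurable_compose)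
  then show ?thesis by (simp add: profile_def[abs_def])
qed

lemma profile_continuous:
  assumes "continuous_on unit_ball u"
  shows "continuous_on {0..<1} (profile u)"
proof -
  have "continuous_on {0..<1} (\<lambda>t. sqrt t *\<^sub>R axis 1 1 :: R2)" by (intro continuous_intros)
  moreover have "(\<lambda>t. sqrt t *\<^sub>R axis 1 1 :: R2) ` {0..<1} \<subseteq> unit_ball"
    by (auto simp: unit_ball_def norm_axis_1)
  ultimately have "continuous_on {0..<1} (\<lambda>t. u (sqrt t *\<^sub>R axis 1 1))"
    by (rule continuous_on_compose2[OF assms])
  then show ?thesis by (simp add: profile_def[abs_def])
qed

definition source :: "real \<Rightarrow> (R2 \<Rightarrow> real) \<Rightarrow> real \<Rightarrow> real" where
  "source p u t = \<bar>profile u t\<bar> powr (p - 1) * profile u t"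

lemma source_continuous:
  assumes "continuous_on unit_ball u" "1 < p"
  shows "continuous_on {0..<1} (source p u)"
  unfolding source_def[abs_def] using assms(2)
  by (intro continuous_on_mult continuous_on_powr' continuous_intros profile_continuous assms(1)) auto

text \<open>Up to the factor \<pi>, the integral of |u|^(p-1) u over the disc |x|^2 <= q. The
  Laplacian of U(|x|^2) is 4 (t U')', so the integrated equation reads 4 t U' = - F.\<close>

definition flux :: "real \<Rightarrow> (R2 \<Rightarrow> real) \<Rightarrow> real \<Rightarrow> real" where
  "flux p u q = integral {0..q} (source p u)"

lemma flux_deriv_within:
  assumes "continuous_on unit_ball u" "1 < p" "b < 1" "t \<in> {0..b}"
  shows "(flux p u has_real_derivative source p u t) (at t within {0..b})"
  unfolding flux_def[abs_def] using assms
  by (intro integral_has_real_derivative continuous_on_subset[OF source_continuous]) auto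

lemma flux_deriv:
  assumes "continuous_on unit_ball u" "1 < p" "0 < t" "t < 1"
  shows "(flux p u has_real_derivative source p u t) (at t)"
proof -
  have "(flux p u has_real_derivative source p u t) (at t within {0..(1 + t) / 2})"
    using assms by (intro flux_deriv_within) auto
  moreover have "at t within {0..(1 + t) / 2} = at t" using assms by (intro at_within_interior) auto
  ultimately show ?thesis by simp
qed

lemma flux_continuous:
  assumes "continuous_on unit_ball u" "1 < p" "b < 1"
  shows "continuous_on {0..b} (flux p u)"
  using flux_deriv_within[OF assms] by (rule DERIV_continuous_on)

text \<open>The twice integrated equation, 4 U + (integral of F / t) = const, in weak form: it needs
  no derivative of U. It arises by choosing the test function R(|x|^2) so that (t R')' = k, and then
  integrating the source term by parts twice.\<close>

lemma profile_weak_identity: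
  assumes rad: "radial u" and sol: "weak_solution p u" and uc: "continuous_on unit_ball u" and p: "1 < p"
    and ab: "0 < a" "a < b" "b < 1"
    and kc: "continuous_on UNIV k" and k0: "\<And>t. t \<notin> {a..b} \<Longrightarrow> k t = 0" and ki: "integral {a..b} k = 0"
  shows "integral {a..b} (\<lambda>t. (4 * profile u t + integral {a..t} (\<lambda>t. flux p u t / t)) * k t) = 0"
proof -
  define U f F where "U = profile u" and "f = source p u" and "F = flux p u"
  define Q where "Q t = integral {a..t} (\<lambda>t. F t / t)" for t
  have u: "H10 u" using sol by (simp add: weak_solution_def)
  have Uc: "continuous_on {0..<1} U" and fc: "continuous_on {0..<1} f"
    unfolding U_def f_def using profile_continuous source_continuous uc p by auto
  have Uc': "continuous_on {x..b} U" and fc': "continuous_on {x..b} f" if "0 \<le> x" for x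
    using that ab by (auto intro: continuous_on_subset[OF Uc] continuous_on_subset[OF fc])
  have Fc: "continuous_on {x..b} F" if "0 \<le> x" for x
    unfolding F_def by (rule continuous_on_subset[OF flux_continuous[OF uc p ab(3)]]) (use that in auto)
  have Um[measurable]: "U \<in> borel_measurable borel"
    unfolding U_def using u by (intro profile_measurable) (simp add: H10_def)
  have Uu: "U (x \<bullet> x) = u x" for x unfolding U_def by (rule profile_inner[OF rad])
  have fu: "f (x \<bullet> x) = \<bar>u x\<bar> powr (p - 1) * u x" for x
    by (simp add: f_def source_def Uu[unfolded U_def])
  have [measurable]: "f \<in> borel_measurable borel" unfolding f_def source_def[abs_def] U_def[symmetric] by measurable
  have [measurable]: "k \<in> borel_measurable borel" using kc by (rule borel_measurable_continuous_onI)
  obtain K where K: "\<And>x. (K has_real_derivative k x) (at x)" using antiderivative_UNIV[OF kc] by blast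
  \<comment> \<open>\<open>X\<close> is t R'. It vanishes outside [a, b] precisely because k does
    and has mean zero; as a > 0, the quotient P = X / t has no singularity at 0.\<close>
  define X where "X t = K t - K a" for t
  have dX: "(X has_real_derivative k t) (at t)" for t
    unfolding X_def by (auto intro!: derivative_eq_intros K)
  have Xc: "continuous_on S X" for S using deriv_continuous_UNIV[OF dX] by (rule continuous_on_subset) simp
  have X_lo: "X t = 0" if "t \<le> a" for t
  proof (cases "t = a")
    case False
    then have "t < a" using that by simp
    moreover have "continuous_on {t..a} X" by (rule Xc)
    moreover have "\<And>s. t < s \<Longrightarrow> s < a \<Longrightarrow> (X has_real_derivative 0) (at s)"
      using dX k0 by (metis atLeastAtMost_iff not_le)
    ultimately have "X a = X t" by (rule DERIV_isconst_end)
    then show ?thesis by (simp add: X_def)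
  qed (simp add: X_def)
  have Xb: "X b = 0"
  proof -
    have "(k has_integral X b - X a) {a..b}"
      using ab dX by (intro fundamental_theorem_of_calculus)
        (auto simp flip: has_real_derivative_iff_has_vector_derivative intro: has_field_derivative_at_within)
    then show ?thesis using ki by (simp add: X_def integral_unique)
  qed
  have X_hi: "X t = 0" if "b \<le> t" for t
  proof (cases "t = b")
    case False
    then have "b < t" using that by simp
    moreover have "continuous_on {b..t} X" by (rule Xc)
    moreover have "\<And>s. b < s \<Longrightarrow> s < t \<Longrightarrow> (X has_real_derivative 0) (at s)"
      using dX k0 by (metis atLeastAtMost_iff not_le)
    ultimately have "X t = X b" by (rule DERIV_isconst_end)
    then show ?thesis using Xb by simp
  qed (simp add: Xb)
  define P where "P t = X t / t" for t
  define P' where "P' t = k t / t - X t / t\<^sup>2" for t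
  have dP: "(P has_real_derivative P' t) (at t)" for t
  proof (cases "t < a")
    case True
    have "((\<lambda>_. 0) has_real_derivative P' t) (at t)"
      using True k0[of t] X_lo[of t] by (simp add: P'_def)
    then show ?thesis
      by (rule has_field_derivative_transform_within_open[of _ _ _ "{..<a}"]) (use True X_lo in \<open>auto simp: P_def\<close>)
  next
    case False
    then show ?thesis unfolding P_def P'_def using ab
      by (auto intro!: derivative_eq_intros dX simp: field_simps power2_eq_square)
  qed
  have P'c: "continuous_on UNIV P'"
  proof -
    have "continuous_on {..<a} P'"
      by (subst continuous_on_cong[OF refl, of _ _ "\<lambda>_. 0"]) (auto simp: P'_def X_lo k0)
    moreover have "continuous_on {0<..} P'" unfolding P'_def
      by (intro continuous_intros Xc continuous_on_subset[OF kc]) auto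
    ultimately have "continuous_on ({..<a} \<union> {0<..}) P'" by (intro continuous_on_open_Un) auto
    moreover have "{..<a} \<union> {0<..} = UNIV" using ab by auto
    ultimately show ?thesis by simp
  qed
  have P_hi: "P t = 0" if "b \<le> t" for t using that X_hi by (simp add: P_def)
  have P_lo: "P t = 0" if "t \<le> a" for t using that X_lo by (simp add: P_def)
  have PP': "P t + t * P' t = k t" for t
    using ab k0[of 0] by (cases "t = 0") (auto simp: P_def P'_def X_lo power2_eq_square field_simps)
  have Pc: "continuous_on UNIV P" by (rule deriv_continuous_UNIV[OF dP])
  obtain R0 where R0: "\<And>x. (R0 has_real_derivative P x) (at x)" using antiderivative_UNIV[OF Pc] by blast
  \<comment> \<open>\<open>R\<close> vanishes beyond b, but on [0, a] it is a constant, in general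
    not 0. The test function thus sees the source around the origin, and this fixes the integration
    constant through F 0 = 0.\<close>
  define R where "R t = R0 t - R0 b" for t
  have dR: "(R has_real_derivative P t) (at t)" for t
    unfolding R_def by (auto intro!: derivative_eq_intros R0)
  have Rc: "continuous_on S R" for S using deriv_continuous_UNIV[OF dR] by (rule continuous_on_subset) simp
  have [measurable]: "R \<in> borel_measurable borel" using Rc[of UNIV] by (rule borel_measurable_continuous_onI)
  have R_hi: "R t = 0" if "b \<le> t" for t
  proof (cases "t = b")
    case False
    then have "b < t" using that by simp
    moreover have "continuous_on {b..t} R" by (rule Rc)
    moreover have "\<And>s. b < s \<Longrightarrow> s < t \<Longrightarrow> (R has_real_derivative 0) (at s)"
      using dR P_hi by (metis less_imp_le)
    ultimately have "R t = R b" by (rule DERIV_isconst_end)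
    then show ?thesis by (simp add: R_def)
  qed (simp add: R_def)
  have "test_fun unit_ball (\<lambda>x. R (x \<bullet> x)) (\<lambda>x. (2 * P (x \<bullet> x)) *\<^sub>R x)"
    by (rule test_fun_radial[OF dR Pc R_hi ab(3)])
  then have "(LINT x|lborel. wgrad u x \<bullet> ((2 * P (x \<bullet> x)) *\<^sub>R x)) = (LINT x|lborel. \<bar>u x\<bar> powr (p - 1) * u x * R (x \<bullet> x))"
    using sol unfolding weak_solution_def by blast
  moreover have "(LINT x|lborel. wgrad u x \<bullet> ((2 * P (x \<bullet> x)) *\<^sub>R x)) = - (4 * pi * integral {a..b} (\<lambda>t. U t * k t))"
  proof -
    have "(LINT x|lborel. wgrad u x \<bullet> ((2 * P (x \<bullet> x)) *\<^sub>R x)) = 2 * (LINT x|lborel. P (x \<bullet> x) * (wgrad u x \<bullet> x))"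
      by (simp add: mult.assoc)
    also have "(LINT x|lborel. P (x \<bullet> x) * (wgrad u x \<bullet> x)) = - (LINT x|lborel. u x * (2 * k (x \<bullet> x)))"
      using weak_gradient_radial_field(3)[OF u dP P'c P_hi, of b] by (simp add: PP')
    also have "(LINT x|lborel. u x * (2 * k (x \<bullet> x))) = 2 * (LINT x|lborel. U ((x::R2) \<bullet> x) * k (x \<bullet> x))"
      by (simp add: Uu mult.left_commute[of _ 2])
    also have "(LINT x|lborel. U ((x::R2) \<bullet> x) * k (x \<bullet> x)) = pi * integral {a..b} (\<lambda>t. U t * k t)"
      using ab k0 by (intro integral_inner_self[where f = "\<lambda>t. U t * k t"] continuous_intros Uc' continuous_on_subset[OF kc]) auto
    finally show ?thesis by simp
  qed
  moreover have "(LINT x|lborel. \<bar>u x\<bar> powr (p - 1) * u x * R (x \<bullet> x)) = pi * integral {0..b} (\<lambda>t. f t * R t)"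
  proof -
    have "(LINT x|lborel. f ((x::R2) \<bullet> x) * R (x \<bullet> x)) = pi * integral {0..b} (\<lambda>t. f t * R t)"
      using ab R_hi by (intro integral_inner_self[where f = "\<lambda>t. f t * R t"] continuous_intros fc' Rc) auto
    then show ?thesis by (simp add: fu)
  qed
  ultimately have "pi * (4 * integral {a..b} (\<lambda>t. U t * k t) + integral {0..b} (\<lambda>t. f t * R t)) = 0"
    by (simp add: distrib_left)
  then have main: "4 * integral {a..b} (\<lambda>t. U t * k t) + integral {0..b} (\<lambda>t. f t * R t) = 0"
    by (subst (asm) mult_eq_0_iff) simp
  have "((\<lambda>t. f t * R t + F t * P t) has_integral F b * R b - F 0 * R 0) {0..b}"
  proof (rule fundamental_theorem_of_calculus)
    fix t assume t: "t \<in> {0..b}"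
    show "((\<lambda>t. F t * R t) has_vector_derivative f t * R t + F t * P t) (at t within {0..b})"
      unfolding has_real_derivative_iff_has_vector_derivative[symmetric]
      using flux_deriv_within[OF uc p ab(3) t]
      by (auto intro!: derivative_eq_intros has_field_derivative_at_within[OF dR] simp: F_def f_def)
  qed (use ab in auto)
  moreover have "F 0 = 0" by (simp add: F_def flux_def)
  ultimately have "integral {0..b} (\<lambda>t. f t * R t + F t * P t) = 0" using R_hi by (simp add: integral_unique)
  moreover have "integral {0..b} (\<lambda>t. f t * R t + F t * P t) = integral {0..b} (\<lambda>t. f t * R t) + integral {0..b} (\<lambda>t. F t * P t)"
    by (intro integral_add integrable_continuous_real continuous_intros fc' Fc Rc continuous_on_subset[OF Pc]) auto
  moreover have "integral {0..b} (\<lambda>t. F t * P t) = integral {a..b} (\<lambda>t. F t * P t)"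
  proof -
    have "integral {0..a} (\<lambda>t. F t * P t) + integral {a..b} (\<lambda>t. F t * P t) = integral {0..b} (\<lambda>t. F t * P t)"
      using ab by (intro Henstock_Kurzweil_Integration.integral_combine integrable_continuous_real continuous_intros Fc continuous_on_subset[OF Pc]) auto
    moreover have "integral {0..a} (\<lambda>t. F t * P t) = integral {0..a} (\<lambda>_. 0)"
      by (rule integral_cong) (simp add: P_lo)
    ultimately show ?thesis by simp
  qed
  moreover have "integral {a..b} (\<lambda>t. F t * P t) + integral {a..b} (\<lambda>t. Q t * k t) = 0"
  proof -
    have Fq: "continuous_on {a..b} (\<lambda>t. F t / t)" using ab by (intro continuous_intros Fc) auto
    have dQ: "(Q has_real_derivative F t / t) (at t within {a..b})" if "t \<in> {a..b}" for t
      unfolding Q_def[abs_def] by (rule integral_has_real_derivative[OF Fq that])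
    have Qc: "continuous_on {a..b} Q" using dQ by (rule DERIV_continuous_on)
    have "((\<lambda>t. F t * P t + Q t * k t) has_integral Q b * X b - Q a * X a) {a..b}"
    proof (rule fundamental_theorem_of_calculus)
      fix t assume t: "t \<in> {a..b}"
      show "((\<lambda>t. Q t * X t) has_vector_derivative F t * P t + Q t * k t) (at t within {a..b})"
        unfolding has_real_derivative_iff_has_vector_derivative[symmetric]
        by (auto intro!: derivative_eq_intros has_field_derivative_at_within[OF dX] dQ t simp: P_def)
    qed (use ab in auto)
    then have "integral {a..b} (\<lambda>t. F t * P t + Q t * k t) = 0" using X_hi[of b] X_lo[of a] by (simp add: integral_unique)
    moreover have "integral {a..b} (\<lambda>t. F t * P t + Q t * k t) = integral {a..b} (\<lambda>t. F t * P t) + integral {a..b} (\<lambda>t. Q t * k t)"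
      using ab by (intro integral_add integrable_continuous_real continuous_intros Fc Qc continuous_on_subset[OF Pc] continuous_on_subset[OF kc]) auto
    ultimately show ?thesis by simp
  qed
  moreover have "integral {a..b} (\<lambda>t. (4 * U t + Q t) * k t) = 4 * integral {a..b} (\<lambda>t. U t * k t) + integral {a..b} (\<lambda>t. Q t * k t)"
  proof -
    have Fq: "continuous_on {a..b} (\<lambda>t. F t / t)" using ab by (intro continuous_intros Fc) auto
    have "continuous_on {a..b} Q" unfolding Q_def[abs_def]
      by (rule DERIV_continuous_on) (rule integral_has_real_derivative[OF Fq])
    then have "(\<lambda>t. Q t * k t) integrable_on {a..b}" "(\<lambda>t. 4 * (U t * k t)) integrable_on {a..b}"
      using ab by (auto intro!: integrable_continuous_real continuous_intros Uc' continuous_on_subset[OF kc])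
    then have "integral {a..b} (\<lambda>t. 4 * (U t * k t) + Q t * k t) = integral {a..b} (\<lambda>t. 4 * (U t * k t)) + integral {a..b} (\<lambda>t. Q t * k t)"
      by (intro integral_add)
    moreover have "(4 * U t + Q t) * k t = 4 * (U t * k t) + Q t * k t" for t by (simp add: algebra_simps)
    ultimately show ?thesis by (simp only: integral_mult_right)
  qed
  ultimately have "integral {a..b} (\<lambda>t. (4 * U t + Q t) * k t) = 0" using main by linarith
  then show ?thesis by (simp add: U_def Q_def F_def)
qed

text \<open>By du Bois-Reymond, 4 U + (integral of F / t) is constant around q; F / t is continuous
  there, so U inherits its derivative from the integral.\<close>

lemma profile_deriv:
  assumes rad: "radial u" and sol: "weak_solution p u" and uc: "continuous_on unit_ball u" and p: "1 < p"
    and q: "0 < q" "q < 1"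
  shows "(profile u has_real_derivative - flux p u q / (4 * q)) (at q)"
proof -
  define a b where "a = q / 2" and "b = (1 + q) / 2"
  have ab: "0 < a" "a < b" "b < 1" "a < q" "q < b" using q by (auto simp: a_def b_def)
  define Q where "Q t = integral {a..t} (\<lambda>t. flux p u t / t)" for t
  have "continuous_on {a..b} (\<lambda>t. flux p u t / t)"
    using ab by (intro continuous_intros continuous_on_subset[OF flux_continuous[OF uc p ab(3)]]) auto
  then have dQ: "(Q has_real_derivative flux p u t / t) (at t within {a..b})" if "t \<in> {a..b}" for t
    unfolding Q_def[abs_def] using that by (rule integral_has_real_derivative)
  have "continuous_on {a..b} (\<lambda>t. 4 * profile u t + Q t)"
    using ab by (intro continuous_intros DERIV_continuous_on[OF dQ] continuous_on_subset[OF profile_continuous[OF uc]]) auto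
  then have "\<exists>c. \<forall>t. a < t \<and> t < b \<longrightarrow> 4 * profile u t + Q t = c"
    using profile_weak_identity[OF rad sol uc p ab(1-3)] unfolding Q_def[symmetric]
    by (rule du_Bois_Reymond[OF ab(2)])
  then obtain c where c: "\<And>t. a < t \<Longrightarrow> t < b \<Longrightarrow> 4 * profile u t + Q t = c" by blast
  have "at q within {a..b} = at q" using ab by (intro at_within_interior) auto
  then have "(Q has_real_derivative flux p u q / q) (at q)" using dQ[of q] ab by auto
  then have "((\<lambda>t. (c - Q t) / 4) has_real_derivative - flux p u q / (4 * q)) (at q)"
    using q by (auto intro!: derivative_eq_intros)
  then show ?thesis
    by (rule has_field_derivative_transform_within_open[of _ _ _ "{a<..<b}"]) (use ab c in \<open>auto simp: field_simps\<close>)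
qed

section \<open>Boundary values of the profile\<close>

lemma max_0_power2_deriv: "((\<lambda>y::real. (max 0 y)\<^sup>2) has_real_derivative 2 * max 0 y) (at y)"
proof -
  consider "y < 0" | "0 < y" | "y = 0" by linarith
  then show ?thesis
  proof cases
    case 1
    then have "((\<lambda>_. 0) has_real_derivative 2 * max 0 y) (at y)" by simp
    then show ?thesis
      by (rule has_field_derivative_transform_within_open[of _ _ _ "{..<0}"]) (use 1 in auto)
  next
    case 2
    then have "((\<lambda>y. y\<^sup>2) has_real_derivative 2 * max 0 y) (at y)" by (auto intro!: derivative_eq_intros)
    then show ?thesis
      by (rule has_field_derivative_transform_within_open[of _ _ _ "{0<..}"]) (use 2 in auto)
  next
    case 3
    have "((\<lambda>h::real. (max 0 h)\<^sup>2 / h) \<longlongrightarrow> 0) (at 0)"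
    proof (rule Lim_null_comparison[of _ "\<lambda>h. \<bar>h\<bar>"])
      show "\<forall>\<^sub>F h::real in at 0. norm ((max 0 h)\<^sup>2 / h) \<le> \<bar>h\<bar>"
        by (rule always_eventually) (auto simp: max_def power2_eq_square)
      show "((\<lambda>h::real. \<bar>h\<bar>) \<longlongrightarrow> 0) (at 0)" by (rule tendsto_rabs_zero) (rule tendsto_ident_at)
    qed
    then show ?thesis using 3 by (simp add: DERIV_def)
  qed
qed

text \<open>Radial fields concentrated at the unit sphere rule out a jump of \<open>u\<close> across it.\<close>
lemma profile_boundary:
  assumes rad: "radial u" and u: "H10 u" and e: "0 < e" and d: "0 < d" "d < 1"
  shows "\<exists>t. 1 - d < t \<and> t < 1 \<and> profile u t < e"
proof (rule ccontr)
  assume "\<not> ?thesis"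
  then have ge: "e \<le> profile u t" if "1 - d < t" "t < 1" for t using that by force
  define g where "g = wgrad u"
  have wg: "weak_gradient u g" using H10_wgrad[OF u] by (simp add: g_def)
  have [measurable]: "g \<in> borel_measurable lborel" and gi: "integrable lborel (\<lambda>x. (g x $ i)\<^sup>2)" for i
    using wg by (auto simp: weak_gradient_def)
  have "integrable lborel (\<lambda>x. \<Sum>i\<in>UNIV. (g x $ i)\<^sup>2)" using gi by simp
  then have gint: "integrable lborel (\<lambda>x. g x \<bullet> g x)" by (simp add: inner_vec_def power2_eq_square)
  define K where "K = (LINT x|lborel. g x \<bullet> g x)"
  have K: "0 \<le> K" by (simp add: K_def)
  \<comment> \<open>\<open>l\<close> weights the inequality A C <= A^2 + C^2 and \<open>h\<close> is
    the width of the bump, kept inside the zone where U >= e. The choices give l K <= e and 4 \<pi>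
    h / l <= \<pi> e / 2, together less than the lower bound 2 \<pi> e.\<close>
  define l where "l = e / (K + 1)"
  have l: "0 < l" using e K by (simp add: l_def)
  define h where "h = min (d / 2) (l * e / 8)"
  have h: "0 < h" "h < d" "h < 1" "h \<le> l * e / 8" using d e l by (auto simp: h_def)
  \<comment> \<open>A bump with value 1 on the unit sphere; squaring the truncated parabola makes it
    C^1, as a test field must be.\<close>
  define P where "P t = (max 0 (1 - ((t - 1) / h)\<^sup>2))\<^sup>2" for t
  define P' where "P' t = 2 * max 0 (1 - ((t - 1) / h)\<^sup>2) * (- (2 * (t - 1) / h\<^sup>2))" for t
  have dP: "(P has_real_derivative P' t) (at t)" for t
    unfolding P_def[abs_def] P'_def
    by (rule DERIV_chain2[OF max_0_power2_deriv]) (use h in \<open>auto intro!: derivative_eq_intros simp: power2_eq_square field_simps\<close>)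
  have P'c: "continuous_on S P'" for S unfolding P'_def by (intro continuous_intros) (use h in auto)
  have Pc: "continuous_on S P" for S using deriv_continuous_UNIV[OF dP] by (rule continuous_on_subset) simp
  have out: "1 - ((t - 1) / h)\<^sup>2 \<le> 0" if "t \<notin> {1 - h<..<1 + h}" for t
  proof -
    have "h \<le> \<bar>t - 1\<bar>" using that by (auto simp: abs_if)
    then have "1 \<le> \<bar>(t - 1) / h\<bar>" using h by (simp add: abs_divide)
    then have "1 \<le> ((t - 1) / h)\<^sup>2" by (metis abs_one abs_le_square_iff one_power2 abs_abs power2_abs)
    then show ?thesis by simp
  qed
  have P0: "P t = 0" "P' t = 0" if "t \<notin> {1 - h<..<1 + h}" for t
    using out[OF that] by (auto simp: P_def P'_def)
  have P1: "0 \<le> P t" "P t \<le> 1" for t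
  proof -
    have "max 0 (1 - ((t - 1) / h)\<^sup>2) \<le> 1" by simp
    then show "P t \<le> 1" unfolding P_def by (intro power_le_one) auto
  qed (simp add: P_def)
  have P'1: "0 \<le> P' t" if "t \<le> 1" for t
    unfolding P'_def
  proof (intro mult_nonneg_nonneg)
    have "2 * (t - 1) / h\<^sup>2 \<le> 0" using that by (intro divide_nonpos_nonneg) auto
    then show "0 \<le> - (2 * (t - 1) / h\<^sup>2)" by linarith
  qed auto
  have [measurable]: "P \<in> borel_measurable borel" "P' \<in> borel_measurable borel"
    using Pc P'c by (auto intro: borel_measurable_continuous_onI)
  note fld = weak_gradient_radial_field[OF u dP P'c, of "1 + h"]
  \<comment> \<open>Since u = 0 for t >= 1, only the rising half of the bump counts. There (t P)' >=
    0, and 2 e (t P)' has integral 2 e. The minorant \<open>w\<close> jumps at t = 1.\<close>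
  have "2 * pi * e \<le> (LINT x|lborel. u x * (2 * (P (x \<bullet> x) + (x \<bullet> x) * P' (x \<bullet> x))))"
  proof -
    define w where "w t = (if t < 1 then e * (2 * (P t + t * P' t)) else 0)" for t
    have [measurable]: "w \<in> borel_measurable borel" unfolding w_def by measurable
    have "(LINT x|lborel. w ((x::R2) \<bullet> x)) = pi * integral {1 - h..1} (\<lambda>t. e * (2 * (P t + t * P' t)))"
      using h by (intro integral_inner_self continuous_intros Pc P'c) (auto simp: w_def P0)
    also have "integral {1 - h..1} (\<lambda>t. e * (2 * (P t + t * P' t))) = 2 * e * (1 * P 1) - 2 * e * ((1 - h) * P (1 - h))"
    proof (rule integral_unique, rule fundamental_theorem_of_calculus)
      show "((\<lambda>t. 2 * e * (t * P t)) has_vector_derivative e * (2 * (P t + t * P' t))) (at t within {1 - h..1})" for t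
        unfolding has_real_derivative_iff_has_vector_derivative[symmetric]
        by (auto intro!: derivative_eq_intros has_field_derivative_at_within[OF dP] simp: algebra_simps)
    qed (use h in auto)
    also have "\<dots> = 2 * e" using P0[of "1 - h"] by (simp add: P_def)
    finally have "2 * pi * e = (LINT x|lborel. w ((x::R2) \<bullet> x))" by simp
    also have "\<dots> \<le> (LINT x|lborel. u x * (2 * (P (x \<bullet> x) + (x \<bullet> x) * P' (x \<bullet> x))))"
    proof (rule integral_mono')
      show "integrable lborel (\<lambda>x. u x * (2 * (P (x \<bullet> x) + (x \<bullet> x) * P' (x \<bullet> x))))"
        by (rule fld(2)) (simp add: P0)
      fix x :: R2
      define t where "t = x \<bullet> x"
      have t: "0 \<le> t" by (simp add: t_def)
      have ut: "u x = profile u t" unfolding t_def by (rule profile_inner[OF rad, symmetric])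
      have *: "w t \<le> u x * (2 * (P t + t * P' t)) \<and> 0 \<le> u x * (2 * (P t + t * P' t))"
      proof (cases "t < 1")
        case False
        then have "x \<notin> unit_ball" by (simp add: unit_ball_def t_def norm_eq_sqrt_inner)
        then have "u x = 0" using u by (simp add: H10_def)
        then show ?thesis using False by (simp add: w_def)
      next
        case True
        have n: "0 \<le> 2 * (P t + t * P' t)" using t P1 P'1 True by simp
        show ?thesis
        proof (cases "t \<le> 1 - h")
          case True
          then show ?thesis using P0[of t] by (simp add: w_def)
        next
          case False
          then have "e \<le> u x" using ge[of t] True h ut by simp
          then show ?thesis using n e True by (simp add: w_def mult_right_mono)
        qed
      qed
      show "w (x \<bullet> x) \<le> u x * (2 * (P (x \<bullet> x) + (x \<bullet> x) * P' (x \<bullet> x)))"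
        "0 \<le> u x * (2 * (P (x \<bullet> x) + (x \<bullet> x) * P' (x \<bullet> x)))"
        using * by (auto simp: t_def)
    qed
    finally show ?thesis .
  qed
  also have "\<dots> = - (LINT x|lborel. P (x \<bullet> x) * (g x \<bullet> x))"
    unfolding g_def by (rule fld(3)) (simp add: P0)
  also have "\<dots> \<le> \<bar>LINT x|lborel. P (x \<bullet> x) * (g x \<bullet> x)\<bar>" by simp
  also have "\<dots> \<le> (LINT x|lborel. \<bar>P (x \<bullet> x) * (g x \<bullet> x)\<bar>)" by (rule integral_abs_bound)
  also have "\<dots> \<le> (LINT x|lborel. l * (g x \<bullet> g x) + 1 / l * ((x \<bullet> x) * (P (x \<bullet> x))\<^sup>2))"
  proof (rule integral_mono')
    have "integrable lborel (\<lambda>x::R2. indicator (cball 0 (sqrt 2)) x *\<^sub>R ((x \<bullet> x) * (P (x \<bullet> x))\<^sup>2))"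
      by (intro borel_integrable_compact compact_cball continuous_intros continuous_comp_inner_self Pc)
    also have "(\<lambda>x::R2. indicator (cball 0 (sqrt 2)) x *\<^sub>R ((x \<bullet> x) * (P (x \<bullet> x))\<^sup>2)) = (\<lambda>x. (x \<bullet> x) * (P (x \<bullet> x))\<^sup>2)"
      using h by (auto simp: fun_eq_iff indicator_def norm_eq_sqrt_inner intro!: P0)
    finally show "integrable lborel (\<lambda>x. l * (g x \<bullet> g x) + 1 / l * ((x \<bullet> x) * (P (x \<bullet> x))\<^sup>2))"
      using gint by simp
    show "0 \<le> l * (g x \<bullet> g x) + 1 / l * ((x \<bullet> x) * (P (x \<bullet> x))\<^sup>2)" for x using l by simp
    show "\<bar>P (x \<bullet> x) * (g x \<bullet> x)\<bar> \<le> l * (g x \<bullet> g x) + 1 / l * ((x \<bullet> x) * (P (x \<bullet> x))\<^sup>2)" for x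
    proof -
      define A where "A = sqrt l * norm (g x)"
      define C where "C = P (x \<bullet> x) * norm x / sqrt l"
      have AC: "0 \<le> A" "0 \<le> C" using l P1 by (auto simp: A_def C_def)
      have "\<bar>P (x \<bullet> x) * (g x \<bullet> x)\<bar> \<le> P (x \<bullet> x) * (norm (g x) * norm x)"
        unfolding abs_mult using P1(1)[of "x \<bullet> x"] by (simp add: mult_left_mono Cauchy_Schwarz_ineq2)
      also have "\<dots> = A * C" using l by (simp add: A_def C_def)
      also have "\<dots> \<le> A\<^sup>2 + C\<^sup>2" using sum_squares_bound[of A C] mult_nonneg_nonneg[OF AC] by linarith
      also have "\<dots> = l * (g x \<bullet> g x) + 1 / l * ((x \<bullet> x) * (P (x \<bullet> x))\<^sup>2)"
        using l by (simp add: A_def C_def power_mult_distrib power_divide dot_square_norm)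
      finally show ?thesis .
    qed
  qed
  also have "\<dots> = l * K + 1 / l * (LINT x|lborel. ((x::R2) \<bullet> x) * (P (x \<bullet> x))\<^sup>2)"
  proof -
    have "integrable lborel (\<lambda>x::R2. indicator (cball 0 (sqrt 2)) x *\<^sub>R ((x \<bullet> x) * (P (x \<bullet> x))\<^sup>2))"
      by (intro borel_integrable_compact compact_cball continuous_intros continuous_comp_inner_self Pc)
    also have "(\<lambda>x::R2. indicator (cball 0 (sqrt 2)) x *\<^sub>R ((x \<bullet> x) * (P (x \<bullet> x))\<^sup>2)) = (\<lambda>x. (x \<bullet> x) * (P (x \<bullet> x))\<^sup>2)"
      using h by (auto simp: fun_eq_iff indicator_def norm_eq_sqrt_inner intro!: P0)
    finally show ?thesis using gint by (simp add: K_def)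
  qed
  also have "(LINT x|lborel. ((x::R2) \<bullet> x) * (P (x \<bullet> x))\<^sup>2) = pi * integral {1 - h..1 + h} (\<lambda>t. t * (P t)\<^sup>2)"
    using h by (intro integral_inner_self[where f = "\<lambda>t. t * (P t)\<^sup>2"] continuous_intros Pc) (auto simp: P0)
  also have "integral {1 - h..1 + h} (\<lambda>t. t * (P t)\<^sup>2) \<le> 4 * h"
  proof -
    have "integral {1 - h..1 + h} (\<lambda>t. t * (P t)\<^sup>2) \<le> integral {1 - h..1 + h} (\<lambda>t. 2)"
    proof (rule integral_le)
      show "t * (P t)\<^sup>2 \<le> 2" if "t \<in> {1 - h..1 + h}" for t
      proof -
        have "t * (P t)\<^sup>2 \<le> 2 * 1" using that h P1[of t] by (intro mult_mono power_le_one) auto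
        then show ?thesis by simp
      qed
    qed (auto intro!: integrable_continuous_real continuous_intros Pc)
    then show ?thesis using h by simp
  qed
  finally have "2 * pi * e \<le> l * K + 1 / l * (pi * (4 * h))" using l by (simp add: mult_left_mono divide_right_mono)
  also have "\<dots> \<le> e + pi * e / 2"
  proof (rule add_mono)
    have "l * K \<le> l * (K + 1)" using l by simp
    then show "l * K \<le> e" using K by (simp add: l_def)
    have "1 / l * (pi * (4 * h)) \<le> 1 / l * (pi * (4 * (l * e / 8)))"
      using h l by (intro mult_left_mono) auto
    then show "1 / l * (pi * (4 * h)) \<le> pi * e / 2" using l by (simp add: field_simps)
  qed
  finally have "3 * (pi * e) \<le> 2 * e" by simp
  moreover have "3 * e < pi * e" using e pi_gt3 by (intro mult_strict_right_mono) auto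
  ultimately show False using e by linarith
qed

section \<open>Emden-Fowler coordinates\<close>

locale nodal_solution =
  fixes p :: real and u :: "R2 \<Rightarrow> real" and r :: real
  assumes p: "1 < p" and rad: "radial u" and sol: "weak_solution p u"
    and uc: "continuous_on unit_ball u" and u0: "u 0 < 0" and r: "0 < r" "r < 1"
    and zero: "\<And>x. x \<in> unit_ball \<Longrightarrow> u x = 0 \<longleftrightarrow> norm x = r"
begin

abbreviation U :: "real \<Rightarrow> real" where "U \<equiv> profile u"
abbreviation F :: "real \<Rightarrow> real" where "F \<equiv> flux p u"

section \<open>Signs of the profile and its limit at the boundary\<close>

lemma U_0: "U 0 = u 0" by (simp add: profile_def)

lemma H10_u: "H10 u" using sol by (simp add: weak_solution_def)

lemma U_1: "U 1 = 0"
  using H10_u by (simp add: H10_def profile_def unit_ball_def norm_axis_1)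

lemma r2: "0 < r\<^sup>2" "r\<^sup>2 < 1" using r by (simp_all add: power_less_one_iff)

lemma U_zero_iff:
  assumes "0 \<le> t" "t < 1"
  shows "U t = 0 \<longleftrightarrow> t = r\<^sup>2"
proof -
  have n: "norm (sqrt t *\<^sub>R axis 1 1 :: R2) = sqrt t" using assms by (simp add: norm_axis_1)
  then have "(sqrt t *\<^sub>R axis 1 1 :: R2) \<in> unit_ball" using assms by (simp add: unit_ball_def)
  then have "U t = 0 \<longleftrightarrow> sqrt t = r" unfolding profile_def using zero n by metis
  also have "\<dots> \<longleftrightarrow> t = r\<^sup>2" using assms r by auto
  finally show ?thesis .
qed

lemma U_cont: "S \<subseteq> {0..<1} \<Longrightarrow> continuous_on S U"
  by (rule continuous_on_subset[OF profile_continuous[OF uc]])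

lemma U_neg:
  assumes "0 \<le> t" "t < r\<^sup>2"
  shows "U t < 0"
proof (rule ccontr)
  assume "\<not> U t < 0"
  moreover have "continuous_on {0..t} U" using assms r2 by (intro U_cont) auto
  ultimately obtain s where "0 \<le> s" "s \<le> t" "U s = 0"
    using IVT'[of U 0 0 t] U_0 u0 assms by auto
  then show False using U_zero_iff[of s] assms r2 by auto
qed

lemma dU: "0 < t \<Longrightarrow> t < 1 \<Longrightarrow> (U has_real_derivative - F t / (4 * t)) (at t)"
  by (rule profile_deriv[OF rad sol uc p])

lemma dF: "0 < t \<Longrightarrow> t < 1 \<Longrightarrow> (F has_real_derivative source p u t) (at t)"
  by (rule flux_deriv[OF uc p])

lemma F_cont: "b < 1 \<Longrightarrow> 0 \<le> a \<Longrightarrow> continuous_on {a..b} F"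
  by (rule continuous_on_subset[OF flux_continuous[OF uc p]]) auto

lemma F_0: "F 0 = 0" by (simp add: flux_def)

lemma F_neg:
  assumes "0 < t" "t \<le> r\<^sup>2"
  shows "F t < 0"
proof -
  have "F t < F 0"
  proof (rule DERIV_neg_imp_decreasing_open[OF assms(1)])
    show "\<exists>d. (F has_real_derivative d) (at s) \<and> d < 0" if "0 < s" "s < t" for s
      using dF[of s] U_neg[of s] that assms r2
      by (intro exI[of _ "source p u s"]) (auto simp: source_def mult_pos_neg)
    show "continuous_on {0..t} F" using assms r2 by (intro F_cont) auto
  qed
  then show ?thesis by (simp add: F_0)
qed

text \<open>The flux is still negative at r^2, so U crosses its zero with positive slope; there is
  no further zero at which the sign could change back.\<close>

lemma U_pos:
  assumes "r\<^sup>2 < t" "t < 1"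
  shows "0 < U t"
proof (rule ccontr)
  assume neg: "\<not> 0 < U t"
  have "0 < - F (r\<^sup>2) / (4 * r\<^sup>2)" using F_neg[of "r\<^sup>2"] r2 by (simp add: divide_neg_pos)
  from DERIV_pos_inc_right[OF dU this] r2
  obtain d where d: "0 < d" "\<And>h. 0 < h \<Longrightarrow> h < d \<Longrightarrow> U (r\<^sup>2) < U (r\<^sup>2 + h)" by auto
  define s where "s = r\<^sup>2 + min (d / 2) ((t - r\<^sup>2) / 2)"
  have s: "r\<^sup>2 < s" "s < t" using d assms by (auto simp: s_def min_def field_simps)
  have "U (r\<^sup>2) < U s" unfolding s_def using d assms by (intro d(2)) auto
  then have "0 < U s" using U_zero_iff[of "r\<^sup>2"] r2 by simp
  moreover have "0 \<le> s" using s r2 by linarith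
  then have "continuous_on {s..t} U" using s assms by (intro U_cont) auto
  ultimately obtain z where "s \<le> z" "z \<le> t" "U z = 0"
    using IVT2'[of U t 0 s] neg s by auto
  then show False using U_zero_iff[of z] s assms r2 by auto
qed

text \<open>\<open>profile_boundary\<close> yields only one point s with a small value. Beyond r^2
  the flux increases, so U' <= M there, and the small value persists from s to 1; positivity bounds
  U from below.\<close>

lemma U_lim:
  assumes e: "0 < e"
  shows "\<exists>s. 0 < s \<and> s < 1 \<and> (\<forall>t. s < t \<and> t < 1 \<longrightarrow> \<bar>U t\<bar> < e)"
proof -
  define M where "M = - F (r\<^sup>2) / (4 * r\<^sup>2)"
  have M: "0 < M" using F_neg[of "r\<^sup>2"] r2 by (simp add: M_def divide_neg_pos)
  define d where "d = min ((1 - r\<^sup>2) / 2) (e / (2 * M))"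
  have d0: "0 < d" using r2 M e by (simp add: d_def)
  have d1: "d \<le> (1 - r\<^sup>2) / 2" "d \<le> e / (2 * M)"
    unfolding d_def by (rule min.cobounded1, rule min.cobounded2)
  have "(1 - t) / 2 < 1 - t" if "t < 1" for t :: real using that by simp
  from d1(1) this[OF r2(2)] have d: "d < 1 - r\<^sup>2" by (rule le_less_trans)
  moreover have "d < 1" using d r2 by linarith
  moreover have "M * d \<le> e / 2" using mult_left_mono[OF d1(2), of M] M by simp
  ultimately have d: "d < 1 - r\<^sup>2" "d < 1" "M * d \<le> e / 2" by auto
  note d = d0 d
  obtain s where s: "1 - d < s" "s < 1" "U s < e / 2"
    using profile_boundary[OF rad H10_u, of "e / 2" d] e d by auto
  have rs: "r\<^sup>2 < s" using s d by simp
  show ?thesis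
  proof (intro exI conjI allI impI)
    show "0 < s" "s < 1" using less_trans[OF r2(1) rs] s by auto
    fix t assume "s < t \<and> t < 1"
    then have t: "s < t" "t < 1" by auto
    have "U t - M * t \<le> U s - M * s"
    proof (rule DERIV_nonpos_imp_decreasing_open[of s t "\<lambda>t. U t - M * t"])
      fix q assume q: "s < q" "q < t"
      have rq: "r\<^sup>2 < q" using rs q(1) by (rule less_trans)
      have q': "0 < q" "q < 1" "r\<^sup>2 < q" using less_trans[OF r2(1) rq] q t rq by auto
      have "F (r\<^sup>2) \<le> F q"
      proof (rule DERIV_nonneg_imp_increasing_open[of "r\<^sup>2" q F])
        show "\<exists>d. (F has_real_derivative d) (at w) \<and> 0 \<le> d" if "r\<^sup>2 < w" "w < q" for w
          using dF[of w] U_pos[of w] that q' r2 by (intro exI[of _ "source p u w"]) (auto simp: source_def)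
        show "continuous_on {r\<^sup>2..q} F" using q' by (intro F_cont) auto
      qed (use q' in auto)
      then have "- F q / (4 * q) \<le> - F (r\<^sup>2) / (4 * q)" using q' by (intro divide_right_mono) auto
      also have "\<dots> \<le> M" unfolding M_def
        by (rule divide_left_mono[OF _ _ mult_pos_pos]) (use F_neg[of "r\<^sup>2"] r2 q' in auto)
      finally show "\<exists>d. ((\<lambda>t. U t - M * t) has_real_derivative d) (at q) \<and> d \<le> 0"
        using dU[OF q'(1,2)] by (intro exI[of _ "- F q / (4 * q) - M"]) (auto intro!: derivative_eq_intros)
    next
      show "continuous_on {s..t} (\<lambda>t. U t - M * t)"
        using less_trans[OF r2(1) rs] t by (intro continuous_intros U_cont) auto
    qed (use t in simp)
    moreover have "M * (t - s) \<le> M * d" using s t d M by (intro mult_left_mono) auto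
    ultimately have "U t < e" using s d by (simp add: algebra_simps)
    moreover have "0 < U t" using U_pos t rs by simp
    ultimately show "\<bar>U t\<bar> < e" by simp
  qed
qed

section \<open>The change of variables and the two arcs\<close>

definition n :: real where "n = p - 1"

definition V :: "real \<Rightarrow> real" where "V y = - U (exp (n * y))"
text \<open>The derivative of \<open>V\<close> in closed form: 4 t U' = - F at t = exp (n y), and
  dt/dy = n t cancels the t.\<close>

definition V' :: "real \<Rightarrow> real" where "V' y = n / 4 * F (exp (n * y))"

definition Y :: real where "Y = 2 / n * ln r"

lemma n_pos: "0 < n" using p by (simp add: n_def)

lemma exp_nY: "exp (n * Y) = r\<^sup>2"
  using n_pos r by (simp add: Y_def exp_double)

lemma Y_neg: "Y < 0" unfolding Y_def using n_pos r by (intro mult_pos_neg) auto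

lemma less_Y_iff: "exp (n * y) < r\<^sup>2 \<longleftrightarrow> y < Y" "r\<^sup>2 < exp (n * y) \<longleftrightarrow> Y < y"
  using n_pos by (auto simp flip: exp_nY)

lemma dV:
  assumes "y < 0"
  shows "(V has_real_derivative V' y) (at y)"
proof -
  have q: "0 < exp (n * y)" "exp (n * y) < 1" using assms n_pos by (auto simp: mult_pos_neg)
  have "((\<lambda>y. exp (n * y)) has_real_derivative n * exp (n * y)) (at y)"
    by (auto intro!: derivative_eq_intros)
  from DERIV_chain2[OF dU[OF q] this]
  have "((\<lambda>y. - U (exp (n * y))) has_real_derivative - (- F (exp (n * y)) / (4 * exp (n * y)) * (n * exp (n * y)))) (at y)"
    by (rule DERIV_minus)
  then show ?thesis by (simp add: V_def[abs_def] V'_def mult.commute)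
qed

lemma dV':
  assumes "y < 0"
  shows "(V' has_real_derivative - (n\<^sup>2 / 4 * (exp y * \<bar>V y\<bar>) powr n * V y)) (at y)"
proof -
  have q: "0 < exp (n * y)" "exp (n * y) < 1" using assms n_pos by (auto simp: mult_pos_neg)
  have "((\<lambda>y. exp (n * y)) has_real_derivative n * exp (n * y)) (at y)"
    by (auto intro!: derivative_eq_intros)
  from DERIV_chain2[OF dF[OF q] this]
  have "((\<lambda>y. n / 4 * F (exp (n * y))) has_real_derivative n / 4 * (source p u (exp (n * y)) * (n * exp (n * y)))) (at y)"
    by (rule DERIV_cmult)
  moreover have "source p u (exp (n * y)) = - (\<bar>V y\<bar> powr n * V y)"
    by (simp add: source_def V_def n_def)
  moreover have "(exp y * \<bar>V y\<bar>) powr n = exp (n * y) * \<bar>V y\<bar> powr n"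
    by (simp add: powr_mult powr_def[of "exp y"])
  ultimately show ?thesis
    by (simp add: V'_def[abs_def] power2_eq_square mult_ac)
qed

lemma V_pos: "y < Y \<Longrightarrow> 0 < V y"
  using U_neg[of "exp (n * y)"] by (simp add: V_def less_Y_iff)

lemma V_neg: "Y < y \<Longrightarrow> y < 0 \<Longrightarrow> V y < 0"
  using U_pos[of "exp (n * y)"] n_pos by (simp add: V_def less_Y_iff mult_pos_neg)

lemma V_Y: "V Y = 0" using U_zero_iff[of "r\<^sup>2"] r2 by (simp add: V_def exp_nY)

lemma V_0: "V 0 = 0" by (simp add: V_def U_1)

lemma V_tendsto_0: "(V \<longlongrightarrow> 0) (at_left 0)"
proof (rule tendstoI)
  fix e :: real assume "0 < e"
  from U_lim[OF this] obtain s where s: "0 < s" "s < 1" "\<And>t. s < t \<Longrightarrow> t < 1 \<Longrightarrow> \<bar>U t\<bar> < e"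
    by auto
  have "dist (V y) 0 < e" if y: "ln s / n < y" "y < 0" for y
  proof -
    have "ln s < y * n" using y(1) by (subst (asm) pos_divide_less_eq[OF n_pos])
    then have "exp (ln s) < exp (n * y)" by (simp only: exp_less_cancel_iff mult.commute)
    moreover have "exp (n * y) < 1" using y(2) n_pos by (simp add: mult_pos_neg)
    ultimately show ?thesis using s(3)[of "exp (n * y)"] s(1) by (simp add: V_def)
  qed
  moreover have "ln s / n < 0" using s(1,2) n_pos by (simp add: divide_neg_pos)
  ultimately show "\<forall>\<^sub>F y in at_left 0. dist (V y) 0 < e"
    unfolding eventually_at_left_field by (intro exI[of _ "ln s / n"]) simp
qed

lemma V_isCont: "y < 0 \<Longrightarrow> isCont V y"
  using dV by (rule DERIV_isCont)

lemma V_cont: "continuous_on {y..0} V"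
  unfolding continuous_on_def
proof (rule ballI)
  fix t assume t: "t \<in> {y..0}"
  show "(V \<longlongrightarrow> V t) (at t within {y..0})"
  proof (cases "t = 0")
    case True
    have "(V \<longlongrightarrow> 0) (at 0 within {..0})"
      using V_tendsto_0 by (simp only: at_within_Iic_at_left)
    then have "(V \<longlongrightarrow> 0) (at 0 within {y..0})" by (rule tendsto_within_subset) auto
    then show ?thesis by (simp only: True V_0)
  next
    case False
    then have "isCont V t" using t by (intro V_isCont) simp
    then show ?thesis unfolding isCont_def by (rule tendsto_within_subset) auto
  qed
qed

text \<open>The factor exp c compensates the shift: exp x times the new function is exp y V at y = c
  + x up to the sign \<open>\<sigma>\<close>, so the equation keeps its form and the wall stays at
  1.\<close>

lemma shifted_arc:
  assumes g: "\<sigma> = 1 \<or> \<sigma> = -1" and B: "0 < B" "c + B \<le> 0"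
    and pos: "\<And>x. c < x \<Longrightarrow> x < c + B \<Longrightarrow> 0 < \<sigma> * V x" and ends: "0 \<le> \<sigma> * V c" "V (c + B) = 0"
  shows "bounce_arc n B (\<lambda>x. \<sigma> * exp c * V (c + x)) (\<lambda>x. \<sigma> * exp c * V' (c + x))"
proof
  show "0 < n" by (rule n_pos)
  show "0 < B" by (rule B)
  fix x :: real
  have d: "((\<lambda>x. c + x) has_real_derivative 1) (at x)" by (auto intro!: derivative_eq_intros)
  {
    assume x: "0 \<le> x" "x < B"
    then have neg: "c + x < 0" using B by simp
    show "((\<lambda>x. \<sigma> * exp c * V (c + x)) has_real_derivative \<sigma> * exp c * V' (c + x)) (at x)"
      using DERIV_cmult[OF DERIV_chain2[OF dV[OF neg] d]] by simp
    have "0 \<le> \<sigma> * V (c + x)" using pos[of "c + x"] ends x by (cases "x = 0") auto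
    then have a: "\<sigma> * V (c + x) = \<bar>V (c + x)\<bar>" using g by (auto simp: abs_if)
    have e: "exp x * (\<sigma> * exp c * V (c + x)) = exp (c + x) * \<bar>V (c + x)\<bar>"
      by (simp add: a[symmetric] exp_add algebra_simps)
    show "((\<lambda>x. \<sigma> * exp c * V' (c + x)) has_real_derivative
        - (n\<^sup>2 / 4 * (exp x * (\<sigma> * exp c * V (c + x))) powr n * (\<sigma> * exp c * V (c + x)))) (at x)"
      unfolding e using DERIV_cmult[OF DERIV_chain2[OF dV'[OF neg] d], of "\<sigma> * exp c"]
      by (simp add: algebra_simps)
  }
  show "0 < \<sigma> * exp c * V (c + x)" if "0 < x" "x < B"
    using pos[of "c + x"] that mult_pos_pos[of "exp c" "\<sigma> * V (c + x)"] by (simp add: mult.left_commute mult.assoc)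
  show "continuous_on {0..B} (\<lambda>x. \<sigma> * exp c * V (c + x))"
    using B by (intro continuous_intros continuous_on_compose2[OF V_cont[of c]]) auto
  show "0 \<le> \<sigma> * exp c * V (c + 0)"
    using mult_nonneg_nonneg[OF _ ends(1), of "exp c"] by (simp add: mult.left_commute mult.assoc)
  show "\<sigma> * exp c * V (c + B) = 0" using ends by simp
qed

text \<open>At \<open>y = - ln (- u 0)\<close> the constant solution \<open>- u 0\<close> would reach the wall \<open>exp y * V y = 1\<close>;
  the first arc is started one unit earlier.\<close>
definition c1 :: real where "c1 = - 1 - ln (- u 0)"

text \<open>With k = - u 0, the bound |U| <= k before the zero gives F >= - k^p t and then U <= - k
  + k^p t / 4. At t = exp (n c1) one has k^p t = k exp (- n): V is constant there up to
  exponentially small errors.\<close>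

lemma start:
  shows "c1 < Y"
    and "exp c1 * V c1 \<le> exp (- 1)" "exp (- 1) * (1 - exp (- n) / 4) \<le> exp c1 * V c1"
    and "exp c1 * V' c1 \<le> 0" "- (n / 4 * exp (- 1) * exp (- n)) \<le> exp c1 * V' c1"
proof -
  define k where "k = - u 0"
  have k: "0 < k" using u0 by (simp add: k_def)
  have U0: "U 0 = - k" by (simp add: U_0 k_def)
  define q where "q = exp (n * c1)"
  have expc: "exp c1 = exp (- 1) / k" using k by (simp add: c1_def exp_diff exp_minus field_simps flip: k_def)
  have "exp (n * (- 1 - ln k)) = exp (- n) * exp (n * - ln k)" by (simp add: algebra_simps flip: exp_add)
  then have q: "q = exp (- n) * k powr (- n)"
    using k by (simp add: q_def c1_def powr_def flip: k_def)
  have kq: "k powr p * q = k * exp (- n)"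
  proof -
    have "k powr p * k powr (- n) = k" using k by (simp add: n_def flip: powr_add)
    then show ?thesis by (simp add: q mult.left_commute)
  qed
  have U_mono: "- k \<le> U t" if t: "0 \<le> t" "t < r\<^sup>2" for t
  proof -
    have "U 0 \<le> U t"
    proof (rule DERIV_nonneg_imp_increasing_open[OF t(1)])
      show "\<exists>d. (U has_real_derivative d) (at w) \<and> 0 \<le> d" if "0 < w" "w < t" for w
        using dU[of w] F_neg[of w] that t r2
        by (intro exI[of _ "- F w / (4 * w)"]) (auto simp: divide_nonpos_pos)
      show "continuous_on {0..t} U" using t r2 by (intro U_cont) auto
    qed
    then show ?thesis by (simp add: U0)
  qed
  have F_low: "- (k powr p * t) \<le> F t" if t: "0 \<le> t" "t \<le> r\<^sup>2" for t
  proof -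
    have "F 0 + k powr p * 0 \<le> F t + k powr p * t"
    proof (rule DERIV_nonneg_imp_increasing_open[OF t(1)])
      fix w assume w: "0 < w" "w < t"
      have "\<bar>U w\<bar> \<le> k" using U_mono[of w] U_neg[of w] w t by auto
      then have "\<bar>U w\<bar> powr (p - 1) * \<bar>U w\<bar> \<le> k powr (p - 1) * k"
        using p by (intro mult_mono powr_mono2) auto
      also have "\<dots> = k powr p" using k by (simp add: powr_diff)
      finally have "0 \<le> source p u w + k powr p" using U_neg[of w] w t by (simp add: source_def)
      moreover have "((\<lambda>t. F t + k powr p * t) has_real_derivative source p u w + k powr p) (at w)"
        using w t r2 by (auto intro!: derivative_eq_intros dF)
      ultimately show "\<exists>d. ((\<lambda>t. F t + k powr p * t) has_real_derivative d) (at w) \<and> 0 \<le> d" by blast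
    next
      show "continuous_on {0..t} (\<lambda>t. F t + k powr p * t)"
        using t r2 by (intro continuous_intros F_cont) auto
    qed
    then show ?thesis by (simp add: F_0)
  qed
  have U_up: "U t \<le> - k + k powr p * t / 4" if t: "0 \<le> t" "t \<le> r\<^sup>2" for t
  proof -
    have "U t - k powr p / 4 * t \<le> U 0 - k powr p / 4 * 0"
    proof (rule DERIV_nonpos_imp_decreasing_open[OF t(1)])
      fix w assume w: "0 < w" "w < t"
      have "- F w / (4 * w) - k powr p / 4 \<le> 0" using F_low[of w] w t by (simp add: field_simps)
      moreover have "((\<lambda>t. U t - k powr p / 4 * t) has_real_derivative - F w / (4 * w) - k powr p / 4) (at w)"
        using w t r2 by (auto intro!: derivative_eq_intros dU)
      ultimately show "\<exists>d. ((\<lambda>t. U t - k powr p / 4 * t) has_real_derivative d) (at w) \<and> d \<le> 0" by blast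
    next
      show "continuous_on {0..t} (\<lambda>t. U t - k powr p / 4 * t)"
        using t r2 by (intro continuous_intros U_cont) auto
    qed
    then show ?thesis by (simp add: U0)
  qed
  \<comment> \<open>The upper bound on U at its zero r^2 forces k^p r^2 >= 4 k, whereas k^p q = k
    exp (- n) < k.\<close>
  have qr: "q < r\<^sup>2"
  proof -
    have "k \<le> k powr p * r\<^sup>2 / 4" using U_up[of "r\<^sup>2"] U_zero_iff[of "r\<^sup>2"] r2 by simp
    moreover have "exp (- n) < 1" using n_pos by simp
    then have "k * exp (- n) < k * 1" using k by (intro mult_strict_left_mono)
    ultimately have "k powr p * q < k powr p * r\<^sup>2" unfolding kq using k by linarith
    then show ?thesis using k by simp
  qed
  then show "c1 < Y" by (simp add: q_def less_Y_iff)
  have q0: "0 < q" by (simp add: q_def)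
  have V: "V c1 = - U q" "V' c1 = n / 4 * F q" by (simp_all add: V_def V'_def q_def)
  have "V c1 \<le> k" "k * (1 - exp (- n) / 4) \<le> V c1"
    using U_mono[of q] U_up[of q] q0 qr kq by (simp_all add: V algebra_simps)
  then have "exp (- 1) / k * V c1 \<le> exp (- 1) / k * k"
    "exp (- 1) / k * (k * (1 - exp (- n) / 4)) \<le> exp (- 1) / k * V c1"
    using k by (intro mult_left_mono; simp)+
  then show "exp c1 * V c1 \<le> exp (- 1)" "exp (- 1) * (1 - exp (- n) / 4) \<le> exp c1 * V c1"
    using k by (simp_all add: expc)
  have "F q \<le> 0" "- (k * exp (- n)) \<le> F q" using F_neg[of q] F_low[of q] q0 qr kq by auto
  then show "exp c1 * V' c1 \<le> 0"
    unfolding V using n_pos by (intro mult_nonneg_nonpos) auto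
  have "n / 4 * (exp (- 1) / k) * (- (k * exp (- n))) \<le> n / 4 * (exp (- 1) / k) * F q"
    using \<open>- (k * exp (- n)) \<le> F q\<close> n_pos k by (intro mult_left_mono) auto
  then show "- (n / 4 * exp (- 1) * exp (- n)) \<le> exp c1 * V' c1"
    using k by (simp add: V expc mult.commute mult.left_commute)
qed

lemma arc1: "bounce_arc n (Y - c1) (\<lambda>x. exp c1 * V (c1 + x)) (\<lambda>x. exp c1 * V' (c1 + x))"
  using shifted_arc[of 1 "Y - c1" c1] start(1) Y_neg V_pos V_Y by (auto intro: less_imp_le)

lemma arc2: "bounce_arc n (- Y) (\<lambda>x. - exp Y * V (Y + x)) (\<lambda>x. - exp Y * V' (Y + x))"
  using shifted_arc[of "-1" "- Y" Y] Y_neg V_neg V_Y V_0 by auto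

lemma V'_cont: "y < 0 \<Longrightarrow> isCont V' y"
  using dV' by (rule DERIV_isCont)

lemma exp_Y: "exp Y = r powr (2 / (p - 1))"
  using r by (simp add: Y_def powr_def n_def)

end


section \<open>The limit of the nodal radius\<close>

text \<open>Strict monotonicity on the positive axis and a sign change between exp (- 1) and 1 give
  existence and uniqueness, which the definite description needs.\<close>

lemma t_bar: "0 < t_bar" "2 * sqrt (exp 1) * ln t_bar + t_bar = 0"
proof -
  define g :: "real \<Rightarrow> real" where "g t = 2 * sqrt (exp 1) * ln t + t" for t
  have mono: "g s < g t" if "0 < s" "s < t" for s t
    using that by (auto simp: g_def intro!: add_strict_mono)
  have "1 \<le> sqrt (exp 1)" by simp
  moreover have "exp (- 1 :: real) < 1" by simp
  ultimately have "g (exp (- 1)) < 0" unfolding g_def ln_exp by linarith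
  moreover have "0 < g 1" by (simp add: g_def)
  moreover have "continuous_on {exp (- 1)..1} g" unfolding g_def
    by (intro continuous_intros) (auto simp: less_le_trans[OF exp_gt_zero] dest: less_le_trans[OF exp_gt_zero])
  ultimately obtain t where t: "exp (- 1) \<le> t" "g t = 0"
    using IVT'[of g "exp (- 1)" 0 1] by auto
  then have "0 < t" using less_le_trans[OF exp_gt_zero] by blast
  have "\<exists>!t. 0 < t \<and> 2 * sqrt (exp 1) * ln t + t = 0"
  proof (rule ex1I[of _ t])
    show "0 < t \<and> 2 * sqrt (exp 1) * ln t + t = 0" using t \<open>0 < t\<close> by (simp add: g_def)
    show "s = t" if "0 < s \<and> 2 * sqrt (exp 1) * ln s + s = 0" for s
      using mono[of s t] mono[of t s] that t \<open>0 < t\<close> by (cases s t rule: linorder_cases) (auto simp: g_def)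
  qed
  from theI'[OF this] show "0 < t_bar" "2 * sqrt (exp 1) * ln t_bar + t_bar = 0"
    unfolding t_bar_def by auto
qed

theorem theorem3:
  fixes u :: "real \<Rightarrow> R2 \<Rightarrow> real" and r :: "real \<Rightarrow> real"
  assumes "\<And>p. p > 1 \<Longrightarrow> least_energy_nodal_radial p (u p)"
    and "\<And>p. p > 1 \<Longrightarrow> continuous_on unit_ball (u p)"
    and "\<And>p. p > 1 \<Longrightarrow> u p 0 < 0"
    and "\<And>p. p > 1 \<Longrightarrow> 0 < r p \<and> r p < 1"
    and "\<And>p x. p > 1 \<Longrightarrow> x \<in> unit_ball \<Longrightarrow> (u p x = 0 \<longleftrightarrow> norm x = r p)"
  shows "((\<lambda>p. r p powr (2 / (p - 1))) \<longlongrightarrow>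
           t_bar * exp (- t_bar / (2 * (t_bar + sqrt (exp 1))))) at_top"
proof -
  have ns: "nodal_solution p (u p) (r p)" if "1 < p" for p
    using assms[of p] that by unfold_locales (auto simp: least_energy_nodal_radial_def)
  have p1: "\<forall>\<^sub>F p :: real in at_top. 1 < p" by (rule eventually_gt_at_top)
  define n where "n p = p - 1" for p :: real
  define Y where "Y p = nodal_solution.Y p (r p)" for p
  define c where "c p = nodal_solution.c1 (u p)" for p
  define V where "V p = nodal_solution.V p (u p)" for p
  define V' where "V' p = nodal_solution.V' p (u p)" for p
  define v1 where "v1 p x = exp (c p) * V p (c p + x)" for p x
  define v1' where "v1' p x = exp (c p) * V' p (c p + x)" for p x
  define v2 where "v2 p x = - exp (Y p) * V p (Y p + x)" for p x
  define v2' where "v2' p x = - exp (Y p) * V' p (Y p + x)" for p x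
  have n: "filterlim n at_top at_top" unfolding n_def by real_asymp
  have nn: "nodal_solution.n p = n p" if "1 < p" for p
    using nodal_solution.n_def[OF ns[OF that]] by (simp add: n_def)
  have arc1: "\<forall>\<^sub>F p in at_top. bounce_arc (n p) (Y p - c p) (v1 p) (v1' p)"
    using p1 by eventually_elim
      (use nodal_solution.arc1[OF ns] in \<open>simp add: nn Y_def c_def v1_def[abs_def] v1'_def[abs_def] V_def V'_def\<close>)
  have arc2: "\<forall>\<^sub>F p in at_top. bounce_arc (n p) (- Y p) (v2 p) (v2' p)"
    using p1 by eventually_elim
      (use nodal_solution.arc2[OF ns] in \<open>simp add: nn Y_def v2_def[abs_def] v2'_def[abs_def] V_def V'_def\<close>)
  have v10: "((\<lambda>p. v1 p 0) \<longlongrightarrow> exp (- 1)) at_top"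
  proof (rule tendsto_sandwich)
    show "\<forall>\<^sub>F p in at_top. exp (- 1) * (1 - exp (- n p) / 4) \<le> v1 p 0"
      using p1 by eventually_elim (use nodal_solution.start(3)[OF ns] in \<open>simp add: nn v1_def c_def V_def\<close>)
    show "\<forall>\<^sub>F p in at_top. v1 p 0 \<le> exp (- 1)"
      using p1 by eventually_elim (use nodal_solution.start(2)[OF ns] in \<open>simp add: v1_def c_def V_def\<close>)
    show "((\<lambda>p. exp (- 1) * (1 - exp (- n p) / 4)) \<longlongrightarrow> exp (- 1)) at_top"
      unfolding n_def by real_asymp
  qed simp
  have v1'0: "((\<lambda>p. v1' p 0) \<longlongrightarrow> 0) at_top"
  proof (rule tendsto_sandwich)
    show "\<forall>\<^sub>F p in at_top. - (n p / 4 * exp (- 1) * exp (- n p)) \<le> v1' p 0"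
      using p1 by eventually_elim (use nodal_solution.start(5)[OF ns] in \<open>simp add: nn v1'_def c_def V'_def\<close>)
    show "\<forall>\<^sub>F p in at_top. v1' p 0 \<le> 0"
      using p1 by eventually_elim (use nodal_solution.start(4)[OF ns] in \<open>simp add: v1'_def c_def V'_def\<close>)
    show "((\<lambda>p. - (n p / 4 * exp (- 1) * exp (- n p))) \<longlongrightarrow> 0) at_top"
      unfolding n_def by real_asymp
  qed simp
  \<comment> \<open>Eventually the value exceeds exp (- 1) / 2 and the reduced slope exceeds - 3/16
    exp (- 1); over a time of at most 2 this loses no more than 3/8 exp (- 1).\<close>
  have e0: "\<forall>\<^sub>F p in at_top. \<forall>x. 0 < x \<and> x \<le> 1 + 1 \<longrightarrow> 0 < v1 p 0 + (v1' p 0 - exp (- 1) / 8) * x"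
  proof -
    have "\<forall>\<^sub>F p in at_top. exp (- 1) / 2 < v1 p 0" by (rule order_tendstoD(1)[OF v10]) simp
    moreover have "\<forall>\<^sub>F p in at_top. - exp (- 1) / 16 < v1' p 0" by (rule order_tendstoD(1)[OF v1'0]) simp
    ultimately show ?thesis
    proof eventually_elim
      case (elim p)
      show ?case
      proof (intro allI impI)
        fix x :: real assume x: "0 < x \<and> x \<le> 1 + 1"
        have "- (exp (- 1) * 3 / 16) * x \<le> (v1' p 0 - exp (- 1) / 8) * x"
          using elim x by (intro mult_right_mono) auto
        moreover have "exp (- 1) * 3 / 16 * x \<le> exp (- 1) * 3 / 16 * 2" using x by (intro mult_left_mono) auto
        ultimately show "0 < v1 p 0 + (v1' p 0 - exp (- 1) / 8) * x"
          using elim exp_gt_zero[of "- 1 :: real"] by linarith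
      qed
    qed
  qed
  have e1: "(exp (- 1) + 0 * 1) * exp 1 = (1::real)" by (simp flip: exp_add)
  \<comment> \<open>The first arc has c0 = exp (- 1), b0 = 0 and T = 1, hence s = 1: it lasts 1 +
    1/2 and ends with slope - 2 exp (- 1).\<close>
  note phase1 = bounce_limit[OF n arc1 v10 v1'0 _ _ _ _ zero_less_one e1 _ e0]
  have B1: "((\<lambda>p. Y p - c p) \<longlongrightarrow> 3 / 2) at_top" using phase1(1) by simp
  \<comment> \<open>\<open>bounce_limit\<close> controls the slope only to the left of the end of
    the arc. As Y < 0 is an interior point, V' is continuous there and the bound passes to the end
    point.\<close>
  have s1: "((\<lambda>p. v1' p (Y p - c p)) \<longlongrightarrow> - (2 * exp (- 1))) at_top"
  proof (rule tendstoI)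
    fix e :: real assume "0 < e"
    then have "\<forall>\<^sub>F p in at_top. \<exists>y<Y p - c p. \<forall>x. y < x \<and> x < Y p - c p \<longrightarrow> \<bar>v1' p x + 2 * exp (- 1)\<bar> < e / 2"
      using phase1(2)[of "e / 2"] by simp
    then show "\<forall>\<^sub>F p in at_top. dist (v1' p (Y p - c p)) (- (2 * exp (- 1))) < e"
      using p1
    proof eventually_elim
      case (elim p)
      define B where "B = Y p - c p"
      have "Y p < 0" using nodal_solution.Y_neg[OF ns[OF elim(2)]] by (simp add: Y_def)
      then have "isCont (V' p) (c p + B)"
        using nodal_solution.V'_cont[OF ns[OF elim(2)]] by (simp add: V'_def B_def)
      then have "isCont (v1' p) B" unfolding v1'_def[abs_def]
        by (intro continuous_intros isCont_o2[of B "\<lambda>x. c p + x"])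
      then have "(v1' p \<longlongrightarrow> v1' p B) (at_left B)"
        by (simp add: isCont_def filterlim_at_split)
      then have "((\<lambda>x. \<bar>v1' p x + 2 * exp (- 1)\<bar>) \<longlongrightarrow> \<bar>v1' p B + 2 * exp (- 1)\<bar>) (at_left B)"
        by (intro tendsto_intros)
      moreover have "\<forall>\<^sub>F x in at_left B. \<bar>v1' p x + 2 * exp (- 1)\<bar> \<le> e / 2"
        using elim(1) unfolding eventually_at_left_field B_def by (meson less_imp_le)
      ultimately have "\<bar>v1' p B + 2 * exp (- 1)\<bar> \<le> e / 2"
        by (rule tendsto_upperbound) simp
      then show ?case using \<open>0 < e\<close> by (simp add: dist_real_def B_def)
    qed
  qed
  \<comment> \<open>The initial slope of the second arc: the final slope 2 exp (- 1) of the first,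
    in modulus, times the rescaling factor exp (Y - c), which tends to exp (3/2).\<close>
  define b0 :: real where "b0 = 2 * exp (1 / 2)"
  \<comment> \<open>With this T, the contact condition b0 T exp T = 1 is exactly the equation
    defining \<open>t_bar\<close>.\<close>
  define T where "T = - ln t_bar"
  have half: "sqrt (exp 1) = exp (1 / 2)"
    by (rule real_sqrt_unique) (simp_all flip: exp_double)
  have "ln t_bar < 0"
  proof -
    have "b0 * ln t_bar + t_bar = 0" using t_bar(2) by (simp add: b0_def half)
    then have "b0 * ln t_bar < b0 * 0" using t_bar(1) by linarith
    then show ?thesis by (subst (asm) mult_less_cancel_left_pos) (simp_all add: b0_def)
  qed
  then have T: "0 < T" by (simp add: T_def)
  have expT: "exp T = 1 / t_bar" using t_bar(1) by (simp add: T_def exp_minus field_simps)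
  have bT: "b0 * T = t_bar" using t_bar(2) by (simp add: b0_def T_def half)
  have e2: "(0 + b0 * T) * exp T = 1" unfolding expT bT using t_bar(1) by simp
  have v20: "((\<lambda>p. v2 p 0) \<longlongrightarrow> 0) at_top"
  proof (rule tendsto_eventually)
    show "\<forall>\<^sub>F p in at_top. v2 p 0 = 0"
      using p1 by eventually_elim (use nodal_solution.V_Y[OF ns] in \<open>simp add: v2_def V_def Y_def\<close>)
  qed
  have v2'0: "((\<lambda>p. v2' p 0) \<longlongrightarrow> b0) at_top"
  proof -
    have "((\<lambda>p. - (exp (Y p - c p) * v1' p (Y p - c p))) \<longlongrightarrow> - (exp (3 / 2) * - (2 * exp (- 1)))) at_top"
      by (intro tendsto_intros B1 s1)
    moreover have "- (exp (Y p - c p) * v1' p (Y p - c p)) = v2' p 0" for p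
      by (simp add: v1'_def v2'_def exp_diff)
    moreover have "- (exp (3 / 2) * - (2 * exp (- 1))) = b0"
      by (simp add: b0_def flip: exp_add)
    ultimately show ?thesis by simp
  qed
  have b0: "0 < b0" by (simp add: b0_def)
  have e0': "\<forall>\<^sub>F p in at_top. \<forall>x. 0 < x \<and> x \<le> T + 1 \<longrightarrow> 0 < v2 p 0 + (v2' p 0 - b0 / 2) * x"
  proof -
    have "\<forall>\<^sub>F p in at_top. b0 / 2 < v2' p 0" by (rule order_tendstoD(1)[OF v2'0]) (use b0 in simp)
    then show ?thesis using p1
      by eventually_elim (use nodal_solution.V_Y[OF ns] in \<open>simp add: v2_def V_def Y_def\<close>)
  qed
  have B2: "((\<lambda>p. - Y p) \<longlongrightarrow> T + 1 / (1 + (1 + b0 * exp T))) at_top"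
    using bounce_limit(1)[OF n arc2 v20 v2'0 _ _ _ _ T e2 _ e0'] b0 by simp
  have "((\<lambda>p. exp (- (- Y p))) \<longlongrightarrow> exp (- (T + 1 / (1 + (1 + b0 * exp T))))) at_top"
    by (intro tendsto_intros B2)
  moreover have "exp (- (T + 1 / (1 + (1 + b0 * exp T)))) = t_bar * exp (- t_bar / (2 * (t_bar + sqrt (exp 1))))"
  proof -
    have "1 / (1 + (1 + b0 * exp T)) = t_bar / (2 * (t_bar + sqrt (exp 1)))"
      using t_bar(1) unfolding expT half b0_def by (simp add: field_simps)
    moreover have "exp (- T) = t_bar" using t_bar(1) by (simp add: T_def)
    ultimately show ?thesis by (simp add: exp_add exp_diff exp_minus field_simps)
  qed
  ultimately have "((\<lambda>p. exp (- (- Y p))) \<longlongrightarrow> t_bar * exp (- t_bar / (2 * (t_bar + sqrt (exp 1))))) at_top"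
    by (simp only:)
  moreover have "\<forall>\<^sub>F p in at_top. exp (- (- Y p)) = r p powr (2 / (p - 1))"
    using p1 by eventually_elim (use nodal_solution.exp_Y[OF ns] in \<open>simp add: Y_def\<close>)
  ultimately show ?thesis by (rule Lim_transform_eventually)
qed

end
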